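(* Let $\alpha\in(0,1)$ and $\kappa_n=n^{1-\alpha}$. Then for each fixed $\theta$, $$\lim_{n} n\,\pi^{(L)}_n(\theta)=\lim_n n\,\pi^{(E)}_n(\theta)=\frac{m(\theta)}{\overline{M}},\qquad \overline{M}=\int_0^1 m(t)\,dt,$$ where $\theta\in[0,1)$ is rational and the limits are taken as $n\to\infty$ through those $n$ with $\theta\in\Theta_n$.
   Context: Model. Fix $n_0\in\mathbb{N}$ (not depending on $n$) and a continuous function $m$ on $[0,1]$. For each $n\ge2$ let $\Theta_n=\{i/n: 0\le i\le n-1\}$, $\kappa_n\in(0,n)$ and $p_n=\kappa_n/n$. Let $(\Omega_O,\mathcal{F}_O,\mathbb{P}_O)$ (depending on $n$) be a probability space carrying independent families of random variables: $(U^O_\theta,\theta\in\Theta_n)$ independent Bernoulli$(p_n)$, and $(Y^O_\theta,\theta\in\Theta_n)$ independent with values in $\{0,1,\dots,n_0\}$, all of these random variables being mutually independent, with mean $\mathbb{E}(Y^O_\theta)=m(\theta)$ and, in addition, $\mathbb{P}_O(Y^O_\theta=0)=0$ for all $\theta\in\Theta_n$. It is assumed that $M_n=\sum_{\theta\in\Theta_n}n^{-1}m(\theta)>0$ for all $n$. Let $K=\Theta_n\times\{0,\dots,n_0\}$ and $$\mathcal{X}^O=\{(\theta,k): U^O_\theta=1,\ 1\le k\le Y^O_\theta\}\subset K.$$ Extended space. Let $\partial\notin K$, $\Omega_A=K\cup\{\partial\}$, $\Omega=\Omega_O\times\Omega_A$, $S((\omega,x))=x$, $\mathcal{F}_W=\{F\times\Omega_A: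 F\in\mathcal{F}_O\}$, $\mathcal{F}=\sigma(\mathcal{F}_W,S)$, and $\mathbb{P}(F\times\Omega_A)=\mathbb{P}_O(F)$ on $\mathcal{F}_W$, with expectation $\mathbb{E}$. Let $\mathcal{X}((\omega,x))=\mathcal{X}^O(\omega)$. Measures. $P_E$ is the probability on $(\Omega,\mathcal{F})$ determined by $$P_E(F\cap\{S=x\})=\frac{\mathbb{P}(F\cap\{x\in\mathcal{X}\})}{\mathbb{E}(|\mathcal{X}|)},\quad F\in\mathcal{F}_W,\ x\in K,$$ and $P_L$ is the probability on $(\Omega,\mathcal{F})$ determined, for $F\in\mathcal{F}_W$ and $B\subset K$, by $$P_L(F\cap\{\mathcal{X}=B\}\cap\{S=x\})=\begin{cases}|B|^{-1}\,\mathbb{P}(F\cap\{\mathcal{X}=B\}\mid\mathcal{X}\neq\emptyset), & x\in B,\\ 0, & x\notin B.\end{cases}$$ Define $Z:K\to\mathbb{R}$ by $Z((\theta,k))=\theta$, write $Z_S$ for $Z(S)$ (defined when $S\in K$, which has probability one under $P_E$ and $P_L$), and for $\theta\in\Theta_n$ put $$\pi_n^{(E)}(\theta)=P_E(Z_S=\theta),\qquad \pi_n^{(L)}(\theta)=P_L(Z_S=\theta).$$ *)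

theory Defs
  imports "HOL-Probability.Probability"
begin

definition Theta :: "nat \<Rightarrow> real set" where
  "Theta n = {real i / real n | i. i < n}"

definition K :: "nat \<Rightarrow> nat \<Rightarrow> (real \<times> nat) set" where
  "K n n0 = Theta n \<times> {0..n0}"

locale original_space = prob_space PO for PO :: "'w measure" +
  fixes n n0 :: nat and m :: "real \<Rightarrow> real" and \<kappa> :: real
    and U Y :: "real \<Rightarrow> 'w \<Rightarrow> nat"
  assumes n_ge_2: "n \<ge> 2"
    and kappa_range: "0 < \<kappa>" "\<kappa> < real n"
    and mutually_indep:
      "indep_vars (\<lambda>_. count_space UNIV) (case_sum U Y) (Theta n <+> Theta n)"
    and U_bernoulli: "\<And>\<theta>. \<theta> \<in> Theta n \<Longrightarrow>
      distr PO (count_space UNIV) (U \<theta>) =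
        measure_pmf (map_pmf of_bool (bernoulli_pmf (\<kappa> / real n)))"
    and Y_range: "\<And>\<theta> \<omega>. \<theta> \<in> Theta n \<Longrightarrow> \<omega> \<in> space PO \<Longrightarrow> Y \<theta> \<omega> \<in> {0..n0}"
    and Y_mean: "\<And>\<theta>. \<theta> \<in> Theta n \<Longrightarrow> expectation (\<lambda>\<omega>. real (Y \<theta> \<omega>)) = m \<theta>"
    and Y_nonzero: "\<And>\<theta>. \<theta> \<in> Theta n \<Longrightarrow> prob {\<omega> \<in> space PO. Y \<theta> \<omega> = 0} = 0"
    and M_pos: "(\<Sum>\<theta>\<in>Theta n. m \<theta> / real n) > 0"

definition XO :: "nat \<Rightarrow> nat \<Rightarrow> (real \<Rightarrow> 'w \<Rightarrow> nat) \<Rightarrow> (real \<Rightarrow> 'w \<Rightarrow> nat)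
    \<Rightarrow> 'w \<Rightarrow> (real \<times> nat) set" where
  "XO n n0 U Y \<omega> = {(\<theta>, k) \<in> K n n0. U \<theta> \<omega> = 1 \<and> 1 \<le> k \<and> k \<le> Y \<theta> \<omega>}"

text \<open>The extended space. The extra point \<open>\<partial>\<close> is rendered as \<^const>\<open>None\<close>, and
  \<open>x \<in> K\<close> as \<open>Some x\<close>.\<close>

definition OmegaA :: "nat \<Rightarrow> nat \<Rightarrow> (real \<times> nat) option set" where
  "OmegaA n n0 = insert None (Some ` K n n0)"

definition Omega :: "'w measure \<Rightarrow> nat \<Rightarrow> nat \<Rightarrow> ('w \<times> (real \<times> nat) option) set" where
  "Omega PO n n0 = space PO \<times> OmegaA n n0"

definition S :: "'w \<times> (real \<times> nat) option \<Rightarrow> (real \<times> nat) option" where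
  "S = snd"

definition X :: "nat \<Rightarrow> nat \<Rightarrow> (real \<Rightarrow> 'w \<Rightarrow> nat) \<Rightarrow> (real \<Rightarrow> 'w \<Rightarrow> nat)
    \<Rightarrow> 'w \<times> (real \<times> nat) option \<Rightarrow> (real \<times> nat) set" where
  "X n n0 U Y w = XO n n0 U Y (fst w)"

definition FW :: "'w measure \<Rightarrow> nat \<Rightarrow> nat \<Rightarrow> ('w \<times> (real \<times> nat) option) set set" where
  "FW PO n n0 = {F \<times> OmegaA n n0 | F. F \<in> sets PO}"

definition FF :: "'w measure \<Rightarrow> nat \<Rightarrow> nat \<Rightarrow> ('w \<times> (real \<times> nat) option) set set" where
  "FF PO n n0 = sigma_sets (Omega PO n n0)
     (FW PO n n0 \<union> {S -` A \<inter> Omega PO n n0 | A. A \<subseteq> OmegaA n n0})"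

text \<open>The probability on \<open>FW\<close>; the first projection recovers \<open>F\<close> from \<open>F \<times> OmegaA\<close>.\<close>

definition PW :: "'w measure \<Rightarrow> nat \<Rightarrow> nat \<Rightarrow> ('w \<times> (real \<times> nat) option) measure" where
  "PW PO n n0 = measure_of (Omega PO n n0) (FW PO n n0) (\<lambda>A. emeasure PO (fst ` A))"

text \<open>\<open>P\<^sub>E\<close> and \<open>P\<^sub>L\<close> are characterised by their values on the sets below, so they are
  described by predicates on measures; existence is proved at the end of this theory.\<close>

definition is_PE :: "'w measure \<Rightarrow> nat \<Rightarrow> nat \<Rightarrow> (real \<Rightarrow> 'w \<Rightarrow> nat) \<Rightarrow> (real \<Rightarrow> 'w \<Rightarrow> nat)
    \<Rightarrow> ('w \<times> (real \<times> nat) option) measure \<Rightarrow> bool" where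
  "is_PE PO n n0 U Y Q \<longleftrightarrow>
     prob_space Q \<and> space Q = Omega PO n n0 \<and> sets Q = FF PO n n0 \<and>
     (\<forall>F \<in> FW PO n n0. \<forall>x \<in> K n n0.
        measure Q (F \<inter> {w \<in> Omega PO n n0. S w = Some x}) =
        measure (PW PO n n0) (F \<inter> {w \<in> Omega PO n n0. x \<in> X n n0 U Y w}) /
        (\<integral>w. real (card (X n n0 U Y w)) \<partial>PW PO n n0))"

definition is_PL :: "'w measure \<Rightarrow> nat \<Rightarrow> nat \<Rightarrow> (real \<Rightarrow> 'w \<Rightarrow> nat) \<Rightarrow> (real \<Rightarrow> 'w \<Rightarrow> nat)
    \<Rightarrow> ('w \<times> (real \<times> nat) option) measure \<Rightarrow> bool" where
  "is_PL PO n n0 U Y Q \<longleftrightarrow>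
     prob_space Q \<and> space Q = Omega PO n n0 \<and> sets Q = FF PO n n0 \<and>
     (\<forall>F \<in> FW PO n n0. \<forall>B \<subseteq> K n n0. \<forall>x \<in> K n n0.
        measure Q (F \<inter> {w \<in> Omega PO n n0. X n n0 U Y w = B} \<inter> {w \<in> Omega PO n n0. S w = Some x}) =
        (if x \<in> B
         then 1 / real (card B) *
           \<P>(w in PW PO n n0. w \<in> F \<and> X n n0 U Y w = B \<bar> X n n0 U Y w \<noteq> {})
         else 0))"

definition Z :: "real \<times> nat \<Rightarrow> real" where
  "Z = fst"

definition prob_ZS :: "nat \<Rightarrow> nat \<Rightarrow> ('w \<times> (real \<times> nat) option) measure \<Rightarrow> real \<Rightarrow> real" where
  "prob_ZS n n0 Q \<theta> = measure Q {w \<in> space Q. \<exists>x \<in> K n n0. S w = Some x \<and> Z x = \<theta>}"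

subsection \<open>Existence of the two measures\<close>

lemma finite_K: "finite (K n n0)"
proof -
  have "Theta n = (\<lambda>i. real i / real n) ` {..<n}" by (auto simp: Theta_def)
  then show ?thesis by (simp add: K_def)
qed

lemma finite_OmegaA: "finite (OmegaA n n0)"
  by (simp add: OmegaA_def finite_K)

lemma sets_pair_eq_FF: "sets (PO \<Otimes>\<^sub>M count_space (OmegaA n n0)) = FF PO n n0"
proof -
  let ?N = "PO \<Otimes>\<^sub>M count_space (OmegaA n n0)"
  have sp: "space ?N = Omega PO n n0" by (simp add: space_pair_measure Omega_def)
  have "FF PO n n0 \<subseteq> sets ?N"
    unfolding FF_def sp[symmetric]
  proof (rule sets.sigma_sets_subset, rule Un_least)
    show "FW PO n n0 \<subseteq> sets ?N" by (auto simp: FW_def intro!: pair_measureI)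
    have "S -` A \<inter> Omega PO n n0 = space PO \<times> A" if "A \<subseteq> OmegaA n n0" for A
      using that by (auto simp: S_def Omega_def)
    then show "{S -` A \<inter> space ?N | A. A \<subseteq> OmegaA n n0} \<subseteq> sets ?N"
      by (auto simp: sp intro!: pair_measureI)
  qed
  moreover have "sets ?N \<subseteq> FF PO n n0"
    unfolding sets_pair_measure
  proof (rule sigma_algebra.sigma_sets_subset)
    have sub: "FW PO n n0 \<union> {S -` A \<inter> Omega PO n n0 | A. A \<subseteq> OmegaA n n0} \<subseteq> Pow (Omega PO n n0)"
      using sets.sets_into_space by (fastforce simp: FW_def Omega_def)
    show sa: "sigma_algebra (space PO \<times> space (count_space (OmegaA n n0))) (FF PO n n0)"
      using sigma_algebra_sigma_sets[OF sub] by (simp add: FF_def Omega_def)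
    interpret sigma_algebra "space PO \<times> space (count_space (OmegaA n n0))" "FF PO n n0" by (rule sa)
    show "{a \<times> b |a b. a \<in> sets PO \<and> b \<in> sets (count_space (OmegaA n n0))} \<subseteq> FF PO n n0"
    proof clarify
      fix a b assume a: "a \<in> sets PO" and b: "b \<in> sets (count_space (OmegaA n n0))"
      have eq: "a \<times> b = (a \<times> OmegaA n n0) \<inter> (S -` b \<inter> Omega PO n n0)"
        using b sets.sets_into_space[OF a] by (auto simp: S_def Omega_def)
      have "a \<times> OmegaA n n0 \<in> FF PO n n0"
        using a unfolding FF_def FW_def by (intro sigma_sets.Basic) auto
      moreover have "S -` b \<inter> Omega PO n n0 \<in> FF PO n n0"
        using b unfolding FF_def by (intro sigma_sets.Basic) auto
      ultimately show "a \<times> b \<in> FF PO n n0" unfolding eq by (rule Int)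
    qed
  qed
  ultimately show ?thesis by auto
qed

lemma sigma_algebra_FW: "sigma_algebra (Omega PO n n0) (FW PO n n0)"
proof -
  have "fst -` A \<inter> Omega PO n n0 = A \<times> OmegaA n n0" if "A \<in> sets PO" for A
    using sets.sets_into_space[OF that] by (auto simp: Omega_def)
  then have "FW PO n n0 = {fst -` A \<inter> Omega PO n n0 | A. A \<in> sets PO}"
    unfolding FW_def by (intro Collect_cong ex_cong) auto
  also have "\<dots> = sets (vimage_algebra (Omega PO n n0) fst PO)"
    by (subst sets_vimage_algebra2) (auto simp: Omega_def)
  finally show ?thesis
    using sets.sigma_algebra_axioms[of "vimage_algebra (Omega PO n n0) fst PO"] by simp
qed

lemma sets_PW: "sets (PW PO n n0) = FW PO n n0"
  unfolding PW_def by (rule sigma_algebra.sets_measure_of_eq[OF sigma_algebra_FW])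

lemma space_PW: "space (PW PO n n0) = Omega PO n n0"
  unfolding PW_def by (rule sigma_algebra.space_measure_of_eq[OF sigma_algebra_FW])

lemma measurable_Pair_None: "(\<lambda>\<omega>. (\<omega>, None)) \<in> measurable PO (PW PO n n0)"
proof (rule measurableI)
  fix A assume "A \<in> sets (PW PO n n0)"
  then obtain F where F: "F \<in> sets PO" "A = F \<times> OmegaA n n0" by (auto simp: sets_PW FW_def)
  then have "(\<lambda>\<omega>. (\<omega>, None)) -` A \<inter> space PO = F"
    using sets.sets_into_space[OF F(1)] by (auto simp: OmegaA_def)
  then show "(\<lambda>\<omega>. (\<omega>, None)) -` A \<inter> space PO \<in> sets PO" using F by simp
qed (auto simp: space_PW Omega_def OmegaA_def)

lemma PW_eq_distr: "PW PO n n0 = distr PO (PW PO n n0) (\<lambda>\<omega>. (\<omega>, None))" (is "_ = ?D")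
proof -
  have "measure_of (Omega PO n n0) (FW PO n n0) (\<lambda>A. emeasure PO (fst ` A)) =
      measure_of (Omega PO n n0) (FW PO n n0) (emeasure ?D)"
  proof (rule measure_of_eq)
    show "FW PO n n0 \<subseteq> Pow (Omega PO n n0)"
      using sets.sets_into_space by (fastforce simp: FW_def Omega_def)
    fix A assume "A \<in> sigma_sets (Omega PO n n0) (FW PO n n0)"
    then have A: "A \<in> FW PO n n0"
      by (simp add: sigma_algebra.sigma_sets_eq[OF sigma_algebra_FW])
    then obtain F where F: "F \<in> sets PO" "A = F \<times> OmegaA n n0" by (auto simp: FW_def)
    then have "(\<lambda>\<omega>. (\<omega>, None)) -` A \<inter> space PO = F" "fst ` A = F"
      using sets.sets_into_space[OF F(1)] by (auto simp: OmegaA_def)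
    then show "emeasure PO (fst ` A) = emeasure ?D A"
      using A by (simp add: emeasure_distr[OF measurable_Pair_None] sets_PW)
  qed
  also have "\<dots> = ?D"
    using measure_of_of_measure[of ?D] by (simp add: sets_PW space_PW)
  finally show ?thesis by (simp only: PW_def[symmetric])
qed

lemma emeasure_PW:
  assumes "F \<in> sets PO"
  shows "emeasure (PW PO n n0) (F \<times> OmegaA n n0) = emeasure PO F"
proof -
  have "(\<lambda>\<omega>. (\<omega>, None)) -` (F \<times> OmegaA n n0) \<inter> space PO = F"
    using sets.sets_into_space[OF assms] by (auto simp: OmegaA_def)
  moreover have "F \<times> OmegaA n n0 \<in> sets (PW PO n n0)" using assms by (auto simp: sets_PW FW_def)
  ultimately show ?thesis
    by (subst PW_eq_distr) (simp add: emeasure_distr[OF measurable_Pair_None])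
qed

lemma measure_PW:
  "F \<in> sets PO \<Longrightarrow> measure (PW PO n n0) (F \<times> OmegaA n n0) = measure PO F"
  by (simp add: measure_def emeasure_PW)

lemma integral_PW:
  fixes f :: "'w \<Rightarrow> real"
  assumes [measurable]: "f \<in> borel_measurable PO"
  shows "(\<integral>w. f (fst w) \<partial>PW PO n n0) = (\<integral>\<omega>. f \<omega> \<partial>PO)"
proof -
  have "fst \<in> measurable (PW PO n n0) PO"
  proof (rule measurableI)
    fix A assume A: "A \<in> sets PO"
    then have "fst -` A \<inter> space (PW PO n n0) = A \<times> OmegaA n n0"
      using sets.sets_into_space[OF A] by (auto simp: space_PW Omega_def)
    then show "fst -` A \<inter> space (PW PO n n0) \<in> sets (PW PO n n0)"
      using A by (auto simp: sets_PW FW_def)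
  qed (auto simp: space_PW Omega_def)
  then have "(\<lambda>w. f (fst w)) \<in> borel_measurable (PW PO n n0)" by measurable
  then show ?thesis
    by (subst PW_eq_distr, subst integral_distr[OF measurable_Pair_None]) auto
qed

lemma ex_measure_on_Omega:
  fixes f :: "real \<times> nat \<Rightarrow> 'w \<Rightarrow> real"
  assumes PO: "prob_space PO"
    and meas: "\<And>x. x \<in> K n n0 \<Longrightarrow> f x \<in> borel_measurable PO"
    and int: "\<And>x. x \<in> K n n0 \<Longrightarrow> integrable PO (f x)"
    and nonneg: "\<And>x \<omega>. 0 \<le> f x \<omega>"
    and total: "(\<Sum>x\<in>K n n0. \<integral>\<omega>. f x \<omega> \<partial>PO) = 1"
  shows "\<exists>Q. prob_space Q \<and> space Q = Omega PO n n0 \<and> sets Q = FF PO n n0 \<and>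
    (\<forall>F\<in>sets PO. \<forall>x\<in>K n n0. measure Q (F \<times> {Some x}) = (\<integral>\<omega>. f x \<omega> * indicator F \<omega> \<partial>PO))"
proof -
  interpret PO: prob_space PO by (rule PO)
  let ?C = "count_space (OmegaA n n0)"
  interpret C: sigma_finite_measure ?C
    by (rule sigma_finite_measure_count_space_finite[OF finite_OmegaA])
  define N where "N = PO \<Otimes>\<^sub>M ?C"
  define g where "g w = (\<Sum>x\<in>K n n0. ennreal (f x (fst w)) * indicator {Some x} (snd w))" for w
  have K_sub: "Some x \<in> OmegaA n n0" if "x \<in> K n n0" for x using that by (auto simp: OmegaA_def)
  have g_meas [measurable]: "g \<in> borel_measurable N"
    unfolding g_def N_def
  proof (intro borel_measurable_sum borel_measurable_times_ennreal)
    fix x assume x: "x \<in> K n n0"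
    note [measurable] = meas[OF x]
    show "(\<lambda>w. ennreal (f x (fst w))) \<in> borel_measurable (PO \<Otimes>\<^sub>M ?C)" by measurable
    have "(\<lambda>a. indicator {Some x} a :: ennreal) \<in> borel_measurable ?C" by simp
    then show "(\<lambda>w. indicator {Some x} (snd w) :: ennreal) \<in> borel_measurable (PO \<Otimes>\<^sub>M ?C)"
      by (rule measurable_compose[OF measurable_snd])
  qed
  define Q where "Q = density N g"
  have spQ: "space Q = Omega PO n n0" by (simp add: Q_def N_def space_pair_measure Omega_def)
  have sets_Q: "sets Q = FF PO n n0" by (simp add: Q_def N_def sets_pair_eq_FF)
  have rect: "emeasure Q (F \<times> A) =
      (\<Sum>x\<in>K n n0. (\<integral>\<^sup>+\<omega>. ennreal (f x \<omega>) * indicator F \<omega> \<partial>PO) * indicator A (Some x))"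
    if F: "F \<in> sets PO" and A: "A \<subseteq> OmegaA n n0" for F A
  proof -
    have FA [measurable]: "F \<times> A \<in> sets N" using F A by (auto simp: N_def intro!: pair_measureI)
    have "emeasure Q (F \<times> A) = (\<integral>\<^sup>+w. g w * indicator (F \<times> A) w \<partial>N)"
      unfolding Q_def by (rule emeasure_density[OF g_meas FA])
    also have "\<dots> = (\<integral>\<^sup>+\<omega>. \<integral>\<^sup>+a. g (\<omega>, a) * indicator (F \<times> A) (\<omega>, a) \<partial>?C \<partial>PO)"
      using C.nn_integral_fst[of "\<lambda>w. g w * indicator (F \<times> A) w" PO] g_meas FA
      unfolding N_def by simp
    also have "\<dots> = (\<integral>\<^sup>+\<omega>. (\<Sum>x\<in>K n n0. (ennreal (f x \<omega>) * indicator F \<omega>) * indicator A (Some x)) \<partial>PO)"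
    proof (rule nn_integral_cong)
      fix \<omega>
      have "(\<integral>\<^sup>+a. g (\<omega>, a) * indicator (F \<times> A) (\<omega>, a) \<partial>?C) =
        (\<integral>\<^sup>+a. (\<Sum>x\<in>K n n0. ((ennreal (f x \<omega>) * indicator F \<omega>) * indicator A (Some x)) * indicator {Some x} a) \<partial>?C)"
        unfolding g_def sum_distrib_right
        by (intro nn_integral_cong sum.cong) (auto simp: indicator_def)
      also have "\<dots> = (\<Sum>x\<in>K n n0. (\<integral>\<^sup>+a. ((ennreal (f x \<omega>) * indicator F \<omega>) * indicator A (Some x)) * indicator {Some x} a \<partial>?C))"
        by (rule nn_integral_sum) auto
      also have "\<dots> = (\<Sum>x\<in>K n n0. (ennreal (f x \<omega>) * indicator F \<omega>) * indicator A (Some x))"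
        by (intro sum.cong refl) (simp add: nn_integral_cmult_indicator K_sub)
      finally show "(\<integral>\<^sup>+a. g (\<omega>, a) * indicator (F \<times> A) (\<omega>, a) \<partial>?C) =
        (\<Sum>x\<in>K n n0. (ennreal (f x \<omega>) * indicator F \<omega>) * indicator A (Some x))" .
    qed
    also have "\<dots> = (\<Sum>x\<in>K n n0. (\<integral>\<^sup>+\<omega>. (ennreal (f x \<omega>) * indicator F \<omega>) * indicator A (Some x) \<partial>PO))"
      using F meas by (intro nn_integral_sum) auto
    also have "\<dots> = (\<Sum>x\<in>K n n0. (\<integral>\<^sup>+\<omega>. ennreal (f x \<omega>) * indicator F \<omega> \<partial>PO) * indicator A (Some x))"
      using F meas by (intro sum.cong refl nn_integral_multc) auto
    finally show ?thesis .
  qed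
  have nn: "(\<integral>\<^sup>+\<omega>. ennreal (f x \<omega>) * indicator F \<omega> \<partial>PO) = ennreal (\<integral>\<omega>. f x \<omega> * indicator F \<omega> \<partial>PO)"
    if "x \<in> K n n0" "F \<in> sets PO" for x F
  proof -
    have "integrable PO (\<lambda>\<omega>. f x \<omega> * indicator F \<omega>)"
      using int[OF that(1)] that(2) by (rule integrable_real_mult_indicator[rotated])
    then have "(\<integral>\<^sup>+\<omega>. ennreal (f x \<omega> * indicator F \<omega>) \<partial>PO) = ennreal (\<integral>\<omega>. f x \<omega> * indicator F \<omega> \<partial>PO)"
      by (rule nn_integral_eq_integral) (simp add: nonneg)
    moreover have "ennreal (f x \<omega>) * indicator F \<omega> = ennreal (f x \<omega> * indicator F \<omega>)" for \<omega>
      by (simp add: indicator_def)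
    ultimately show ?thesis by simp
  qed
  have "emeasure Q (space Q) = (\<Sum>x\<in>K n n0. ennreal (\<integral>\<omega>. f x \<omega> * indicator (space PO) \<omega> \<partial>PO))"
    unfolding spQ Omega_def by (subst rect[OF sets.top subset_refl], intro sum.cong refl)
      (simp only: nn sets.top K_sub indicator_simps mult_1_right)
  also have "\<dots> = (\<Sum>x\<in>K n n0. ennreal (\<integral>\<omega>. f x \<omega> \<partial>PO))"
    by (intro sum.cong refl arg_cong[where f=ennreal] Bochner_Integration.integral_cong) auto
  also have "\<dots> = 1"
    by (subst sum_ennreal) (auto simp: total nonneg)
  finally have prob: "prob_space Q" by (rule prob_spaceI)
  have "measure Q (F \<times> {Some y}) = (\<integral>\<omega>. f y \<omega> * indicator F \<omega> \<partial>PO)"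
    if "F \<in> sets PO" "y \<in> K n n0" for F y
  proof -
    have "emeasure Q (F \<times> {Some y}) = (\<Sum>x\<in>K n n0. if x = y then ennreal (\<integral>\<omega>. f x \<omega> * indicator F \<omega> \<partial>PO) else 0)"
    proof (subst rect[OF that(1)], use that(2) K_sub in blast, rule sum.cong[OF refl])
      fix x assume "x \<in> K n n0"
      then show "(\<integral>\<^sup>+\<omega>. ennreal (f x \<omega>) * indicator F \<omega> \<partial>PO) * indicator {Some y} (Some x) =
          (if x = y then ennreal (\<integral>\<omega>. f x \<omega> * indicator F \<omega> \<partial>PO) else 0)"
        by (cases "x = y") (simp_all add: nn that(1))
    qed
    also have "\<dots> = ennreal (\<integral>\<omega>. f y \<omega> * indicator F \<omega> \<partial>PO)"
      using that by (simp add: finite_K)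
    finally show ?thesis
      by (simp add: measure_def nonneg)
  qed
  with spQ sets_Q prob show ?thesis by blast
qed

context original_space
begin

abbreviation "XX \<equiv> XO n n0 U Y"

lemma XX_subset: "XX \<omega> \<subseteq> K n n0"
  by (auto simp: XO_def)

lemma finite_XX: "finite (XX \<omega>)"
  by (rule finite_subset[OF XX_subset finite_K])

lemma measurable_mem_XX [measurable]: "{\<omega> \<in> space PO. x \<in> XX \<omega>} \<in> events"
proof (cases "x \<in> K n n0")
  case True
  obtain \<theta> k where x: "x = (\<theta>, k)" by force
  have \<theta>: "\<theta> \<in> Theta n" using True by (auto simp: x K_def)
  have rv: "random_variable (count_space UNIV) (case_sum U Y i)" if "i \<in> Theta n <+> Theta n" for i
    using mutually_indep that unfolding indep_vars_def2 by blast
  have [measurable]: "random_variable (count_space UNIV) (U \<theta>)"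
    using rv[OF InlI[OF \<theta>]] by simp
  have [measurable]: "random_variable (count_space UNIV) (Y \<theta>)"
    using rv[OF InrI[OF \<theta>]] by simp
  have "{\<omega> \<in> space PO. x \<in> XX \<omega>} = {\<omega> \<in> space PO. U \<theta> \<omega> = 1 \<and> 1 \<le> k \<and> k \<le> Y \<theta> \<omega>}"
    using True by (auto simp: XO_def x)
  then show ?thesis by simp
next
  case False
  then have "{\<omega> \<in> space PO. x \<in> XX \<omega>} = {}" using XX_subset by auto
  then show ?thesis by (simp only: sets.empty_sets)
qed

lemma sets_XX_eq: "{\<omega> \<in> space PO. XX \<omega> = B} \<in> events"
proof (cases "B \<subseteq> K n n0")
  case True
  have eq: "{\<omega> \<in> space PO. XX \<omega> = B} = {\<omega> \<in> space PO. \<forall>x\<in>K n n0. x \<in> XX \<omega> \<longleftrightarrow> x \<in> B}"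
    using True XX_subset by blast
  have "{\<omega> \<in> space PO. x \<in> XX \<omega> \<longleftrightarrow> x \<in> B} \<in> events" for x
    using measurable_mem_XX[of x] by (cases "x \<in> B") (auto intro: sets.sets_Collect_neg)
  then show ?thesis
    unfolding eq by (intro sets.sets_Collect_finite_All finite_K)
next
  case False
  then have "{\<omega> \<in> space PO. XX \<omega> = B} = {}" using XX_subset by auto
  then show ?thesis by (simp only: sets.empty_sets)
qed

lemma measurable_XX [measurable]: "random_variable (count_space UNIV) XX"
proof -
  have "random_variable (count_space (Pow (K n n0))) XX"
    by (subst measurable_count_space_eq2)
       (use finite_K XX_subset sets_XX_eq in \<open>auto simp: vimage_def Int_def conj_commute\<close>)
  then show ?thesis
    by (rule measurable_compose) simp
qed

lemma card_XX: "real (card (XX \<omega>)) = (\<Sum>x\<in>K n n0. indicator (XX \<omega>) x)"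
  using Int_absorb1[OF XX_subset[of \<omega>]] finite_K[of n n0]
  by (simp add: indicator_def sum_of_bool_eq)

lemma prob_XX_nonempty: "0 < prob {\<omega> \<in> space PO. XX \<omega> \<noteq> {}}"
proof -
  have \<theta>: "0 \<in> Theta n" using n_ge_2 by (auto simp: Theta_def intro!: exI[of _ 0])
  let ?p = "\<kappa> / real n"
  have p: "0 < ?p" "?p < 1" using kappa_range n_ge_2 by (auto simp: field_simps)
  have rv: "random_variable (count_space UNIV) (case_sum U Y i)" if "i \<in> Theta n <+> Theta n" for i
    using mutually_indep that unfolding indep_vars_def2 by blast
  have [measurable]: "random_variable (count_space UNIV) (U 0)"
    using rv[OF InlI[OF \<theta>]] by simp
  have [measurable]: "random_variable (count_space UNIV) (Y 0)"
    using rv[OF InrI[OF \<theta>]] by simp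
  have "prob {\<omega> \<in> space PO. U 0 \<omega> = 1} = measure (distr PO (count_space UNIV) (U 0)) {1}"
    by (subst measure_distr) (auto intro!: arg_cong[where f=prob])
  also have "\<dots> = measure (measure_pmf (bernoulli_pmf ?p)) (of_bool -` {1::nat})"
    by (simp add: U_bernoulli[OF \<theta>])
  also have "of_bool -` {1::nat} = {True}" by (auto simp: of_bool_def split: if_splits)
  also have "measure (measure_pmf (bernoulli_pmf ?p)) {True} = ?p"
    using p by (simp add: measure_pmf_single)
  finally have U: "prob {\<omega> \<in> space PO. U 0 \<omega> = 1} = ?p" .
  have "AE \<omega> in PO. Y 0 \<omega> \<noteq> 0"
    using Y_nonzero[OF \<theta>] by (subst AE_iff_measurable[OF _ refl]) (auto simp: emeasure_eq_measure)
  then have "AE \<omega> in PO. \<omega> \<in> {\<omega> \<in> space PO. U 0 \<omega> = 1} \<longrightarrow> \<omega> \<in> {\<omega> \<in> space PO. XX \<omega> \<noteq> {}}"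
  proof (rule AE_mp, intro AE_I2 impI)
    fix \<omega> assume \<omega>: "\<omega> \<in> space PO" "Y 0 \<omega> \<noteq> 0" "\<omega> \<in> {\<omega> \<in> space PO. U 0 \<omega> = 1}"
    then have "(0, 1) \<in> XX \<omega>"
      using Y_range[OF \<theta> \<omega>(1)] \<theta> by (auto simp: XO_def K_def)
    then show "\<omega> \<in> {\<omega> \<in> space PO. XX \<omega> \<noteq> {}}" using \<omega> by auto
  qed
  then have "prob {\<omega> \<in> space PO. U 0 \<omega> = 1} \<le> prob {\<omega> \<in> space PO. XX \<omega> \<noteq> {}}"
    by (rule finite_measure_mono_AE) measurable
  with U p show ?thesis by simp
qed

lemma integrable_of_XX:
  fixes h :: "(real \<times> nat) set \<Rightarrow> real"
  shows "integrable PO (\<lambda>\<omega>. h (XX \<omega>))"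
proof (rule integrable_const_bound)
  show "AE \<omega> in PO. norm (h (XX \<omega>)) \<le> (\<Sum>B\<in>Pow (K n n0). norm (h B))"
    using XX_subset finite_K by (intro AE_I2 member_le_sum) auto
  show "(\<lambda>\<omega>. h (XX \<omega>)) \<in> borel_measurable PO"
    by (rule measurable_compose[OF measurable_XX]) simp
qed

lemma expectation_card_XX: "0 < expectation (\<lambda>\<omega>. real (card (XX \<omega>)))"
proof -
  have "prob {\<omega> \<in> space PO. XX \<omega> \<noteq> {}} = expectation (\<lambda>\<omega>. of_bool (XX \<omega> \<noteq> {}))"
  proof -
    have "prob {\<omega> \<in> space PO. XX \<omega> \<noteq> {}} = expectation (indicator {\<omega> \<in> space PO. XX \<omega> \<noteq> {}})"
      by simp
    also have "\<dots> = expectation (\<lambda>\<omega>. of_bool (XX \<omega> \<noteq> {}))"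
      by (intro Bochner_Integration.integral_cong) (auto simp: indicator_def)
    finally show ?thesis .
  qed
  also have "\<dots> \<le> expectation (\<lambda>\<omega>. real (card (XX \<omega>)))"
  proof (rule integral_mono)
    fix \<omega>
    show "of_bool (XX \<omega> \<noteq> {}) \<le> real (card (XX \<omega>))"
      using finite_XX[of \<omega>] by (cases "XX \<omega> = {}") (auto simp: Suc_le_eq card_gt_0_iff)
  qed (rule integrable_of_XX)+
  finally show ?thesis using prob_XX_nonempty by simp
qed

theorem ex_PE: "\<exists>Q. is_PE PO n n0 U Y Q"
proof -
  let ?E = "expectation (\<lambda>\<omega>. real (card (XX \<omega>)))"
  define f where "f x \<omega> = indicator (XX \<omega>) x / ?E" for x \<omega>
  have int: "integrable PO (f x)" for x
    using integrable_of_XX[of "\<lambda>B. indicator B x / ?E"] by (simp add: f_def[abs_def])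
  have "(\<Sum>x\<in>K n n0. expectation (f x)) = expectation (\<lambda>\<omega>. \<Sum>x\<in>K n n0. f x \<omega>)"
    using int by (simp add: Bochner_Integration.integral_sum)
  also have "\<dots> = 1"
    using expectation_card_XX by (simp add: f_def card_XX flip: sum_divide_distrib)
  finally have total: "(\<Sum>x\<in>K n n0. expectation (f x)) = 1" .
  have meas: "f x \<in> borel_measurable PO" for x
    by (rule borel_measurable_integrable[OF int])
  have nonneg: "0 \<le> f x \<omega>" for x \<omega>
    using expectation_card_XX by (simp add: f_def)
  obtain Q where Q: "prob_space Q" "space Q = Omega PO n n0" "sets Q = FF PO n n0"
    and eq: "\<And>F x. F \<in> events \<Longrightarrow> x \<in> K n n0 \<Longrightarrow>
      measure Q (F \<times> {Some x}) = expectation (\<lambda>\<omega>. f x \<omega> * indicator F \<omega>)"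
    using ex_measure_on_Omega[OF prob_space_axioms meas int nonneg total] by blast
  have "measure Q (F' \<inter> {w \<in> Omega PO n n0. S w = Some x}) =
      measure (PW PO n n0) (F' \<inter> {w \<in> Omega PO n n0. x \<in> X n n0 U Y w}) /
      (\<integral>w. real (card (X n n0 U Y w)) \<partial>PW PO n n0)"
    if FW: "F' \<in> FW PO n n0" and x: "x \<in> K n n0" for F' x
  proof -
    obtain F where F: "F \<in> events" and F': "F' = F \<times> OmegaA n n0"
      using FW by (auto simp: FW_def)
    note sub = sets.sets_into_space[OF F]
    have G: "F \<inter> {\<omega> \<in> space PO. x \<in> XX \<omega>} \<in> events" using F by auto
    have 1: "F' \<inter> {w \<in> Omega PO n n0. S w = Some x} = F \<times> {Some x}"
      using sub x by (auto simp: F' Omega_def S_def OmegaA_def)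
    have 2: "F' \<inter> {w \<in> Omega PO n n0. x \<in> X n n0 U Y w} =
        (F \<inter> {\<omega> \<in> space PO. x \<in> XX \<omega>}) \<times> OmegaA n n0"
      using sub by (auto simp: F' Omega_def X_def)
    have 3: "(\<integral>w. real (card (X n n0 U Y w)) \<partial>PW PO n n0) = ?E"
      unfolding X_def by (rule integral_PW) (rule measurable_compose[OF measurable_XX], simp)
    have "expectation (\<lambda>\<omega>. f x \<omega> * indicator F \<omega>) =
        expectation (\<lambda>\<omega>. indicator (F \<inter> {\<omega> \<in> space PO. x \<in> XX \<omega>}) \<omega> / ?E)"
      by (intro Bochner_Integration.integral_cong) (auto simp: f_def indicator_def)
    also have "\<dots> = prob (F \<inter> {\<omega> \<in> space PO. x \<in> XX \<omega>}) / ?E"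
      using G by simp
    finally show ?thesis
      unfolding 1 2 3 eq[OF F x] measure_PW[OF G] .
  qed
  with Q show ?thesis unfolding is_PE_def by blast
qed

theorem ex_PL: "\<exists>Q. is_PL PO n n0 U Y Q"
proof -
  let ?q = "prob {\<omega> \<in> space PO. XX \<omega> \<noteq> {}}"
  define f where "f x \<omega> = indicator (XX \<omega>) x / real (card (XX \<omega>)) / ?q" for x \<omega>
  have int: "integrable PO (f x)" for x
    using integrable_of_XX[of "\<lambda>B. indicator B x / real (card B) / ?q"] by (simp add: f_def[abs_def])
  have "(\<Sum>x\<in>K n n0. expectation (f x)) = expectation (\<lambda>\<omega>. \<Sum>x\<in>K n n0. f x \<omega>)"
    using int by (simp add: Bochner_Integration.integral_sum)
  also have "\<dots> = expectation (\<lambda>\<omega>. indicator {\<omega> \<in> space PO. XX \<omega> \<noteq> {}} \<omega> / ?q)"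
  proof (intro Bochner_Integration.integral_cong refl)
    fix \<omega> assume \<omega>: "\<omega> \<in> space PO"
    have "(\<Sum>x\<in>K n n0. f x \<omega>) = real (card (XX \<omega>)) / real (card (XX \<omega>)) / ?q"
      unfolding f_def by (simp only: sum_divide_distrib[symmetric] card_XX[symmetric])
    also have "\<dots> = indicator {\<omega> \<in> space PO. XX \<omega> \<noteq> {}} \<omega> / ?q"
      using \<omega> finite_XX[of \<omega>] by (cases "XX \<omega> = {}") auto
    finally show "(\<Sum>x\<in>K n n0. f x \<omega>) = indicator {\<omega> \<in> space PO. XX \<omega> \<noteq> {}} \<omega> / ?q" .
  qed
  also have "\<dots> = 1"
    using prob_XX_nonempty by simp
  finally have total: "(\<Sum>x\<in>K n n0. expectation (f x)) = 1" .
  have meas: "f x \<in> borel_measurable PO" for x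
    by (rule borel_measurable_integrable[OF int])
  have nonneg: "0 \<le> f x \<omega>" for x \<omega>
    using prob_XX_nonempty by (simp add: f_def)
  obtain Q where Q: "prob_space Q" "space Q = Omega PO n n0" "sets Q = FF PO n n0"
    and eq: "\<And>F x. F \<in> events \<Longrightarrow> x \<in> K n n0 \<Longrightarrow>
      measure Q (F \<times> {Some x}) = expectation (\<lambda>\<omega>. f x \<omega> * indicator F \<omega>)"
    using ex_measure_on_Omega[OF prob_space_axioms meas int nonneg total] by blast
  have "measure Q (F' \<inter> {w \<in> Omega PO n n0. X n n0 U Y w = B} \<inter> {w \<in> Omega PO n n0. S w = Some x}) =
      (if x \<in> B
       then 1 / real (card B) *
         \<P>(w in PW PO n n0. w \<in> F' \<and> X n n0 U Y w = B \<bar> X n n0 U Y w \<noteq> {})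
       else 0)"
    if FW: "F' \<in> FW PO n n0" and x: "x \<in> K n n0" for F' B x
  proof -
    obtain F where F: "F \<in> events" and F': "F' = F \<times> OmegaA n n0"
      using FW by (auto simp: FW_def)
    note sub = sets.sets_into_space[OF F]
    let ?G = "F \<inter> {\<omega> \<in> space PO. XX \<omega> = B}"
    have G: "?G \<in> events" using F sets_XX_eq by auto
    have N: "{\<omega> \<in> space PO. XX \<omega> \<noteq> {}} \<in> events" by measurable
    have 1: "F' \<inter> {w \<in> Omega PO n n0. X n n0 U Y w = B} \<inter> {w \<in> Omega PO n n0. S w = Some x} =
        ?G \<times> {Some x}"
      using sub x by (auto simp: F' Omega_def S_def OmegaA_def X_def)
    have 2: "{w \<in> space (PW PO n n0). (w \<in> F' \<and> X n n0 U Y w = B) \<and> X n n0 U Y w \<noteq> {}} =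
        ?G \<times> OmegaA n n0" if "x \<in> B"
      using sub that by (auto simp: F' Omega_def X_def space_PW)
    have 3: "{w \<in> space (PW PO n n0). X n n0 U Y w \<noteq> {}} =
        {\<omega> \<in> space PO. XX \<omega> \<noteq> {}} \<times> OmegaA n n0"
      by (auto simp: Omega_def X_def space_PW)
    have "expectation (\<lambda>\<omega>. f x \<omega> * indicator ?G \<omega>) =
        expectation (\<lambda>\<omega>. indicator ?G \<omega> * (indicator B x / real (card B) / ?q))"
      by (intro Bochner_Integration.integral_cong) (auto simp: f_def indicator_def)
    also have "\<dots> = prob ?G * (indicator B x / real (card B) / ?q)"
      using G by simp
    finally have "measure Q (?G \<times> {Some x}) = prob ?G * (indicator B x / real (card B) / ?q)"
      unfolding eq[OF G x] .
    then show ?thesis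
    proof (cases "x \<in> B")
      case True
      with \<open>measure Q (?G \<times> {Some x}) = _\<close> show ?thesis
        unfolding 1 cond_prob_def 2[OF True] 3 measure_PW[OF G] measure_PW[OF N]
        by (simp only: if_True indicator_simps times_divide_eq_right mult_1_right
              times_divide_eq_left mult_1_left divide_divide_eq_left mult.commute)
    qed (simp add: 1)
  qed
  with Q show ?thesis unfolding is_PL_def by blast
qed

end

end

theory Submission
  imports Defs "HOL-Real_Asymp.Real_Asymp"
begin

text \<open>
  Write \<open>A\<^sub>\<theta>\<close> for the indicator of \<open>U\<^sub>\<theta> = 1\<close>, let \<open>W\<^sub>\<theta> = A\<^sub>\<theta> Y\<^sub>\<theta>\<close> be the number of points of
  \<open>\<X>\<close> over \<open>\<theta>\<close>, and \<open>N = \<Sum>\<^sub>\<theta> W\<^sub>\<theta> = |\<X>|\<close>. Summing the defining formulas of the two measures over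
  the fibre of \<open>\<theta>\<close> gives
  \<open>\<pi>\<^sub>E(\<theta>) = E[W\<^sub>\<theta>] / E[N]\<close> and \<open>\<pi>\<^sub>L(\<theta>) = E[W\<^sub>\<theta> / N; N > 0] / P(N > 0)\<close>
  (lemmas \<open>prob_ZS_PE\<close> and \<open>prob_ZS_PL\<close>).

  As \<open>E[W\<^sub>\<theta>] = p m(\<theta>)\<close>, the first gives \<open>n \<pi>\<^sub>E(\<theta>) = m(\<theta>) / M\<^sub>n\<close> exactly, where \<open>M\<^sub>n\<close> is a
  Riemann sum of \<open>m\<close>. The limit of \<open>M\<^sub>n\<close> is at least 1, because \<open>Y\<^sub>\<theta> \<ge> 1\<close> almost surely
  forces \<open>m \<ge> 1\<close> on the grid.

  For the second, \<open>N\<close> has mean \<open>\<mu> = \<kappa> M\<^sub>n\<close> and variance \<open>O(\<kappa>)\<close>, and \<open>\<kappa> \<rightarrow> \<infinity>\<close>, so replacing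
  \<open>N\<close> by \<open>\<mu>\<close> should cost little. The difficulty is that the relevant event \<open>A\<^sub>\<theta> = 1\<close> has the
  small probability \<open>\<kappa> / n\<close>, so the error must be small relative to that; and \<open>1 / N\<close> is
  large when \<open>N\<close> is small. Both are dealt with by the number \<open>R = N - W\<^sub>\<theta>\<close> of points elsewhere,
  which is independent of \<open>A\<^sub>\<theta>\<close>. On \<open>A\<^sub>\<theta> = 1\<close> almost surely \<open>1 \<le> W\<^sub>\<theta> \<le> n\<^sub>0\<close>, hence
  \<open>|W\<^sub>\<theta> / N - W\<^sub>\<theta> / \<mu>| \<le> (n\<^sub>0 / \<mu>) A\<^sub>\<theta> (|\<mu> - R| + n\<^sub>0) / (1 + R)\<close>,
  and independence pulls out the factor \<open>E[A\<^sub>\<theta>] = \<kappa> / n\<close> (lemma \<open>expectation_share\<close>). The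
  remaining quotient is small in mean: where \<open>R \<ge> \<kappa> / 8\<close> by the second moment bound
  \<open>E[(\<mu> - R)\<^sup>2] = O(\<kappa>)\<close>, and elsewhere because \<open>P(R < \<kappa> / 8)\<close> is exponentially small by
  the Laplace transform bound \<open>E[exp(- R)] \<le> exp(- \<kappa> / 4)\<close> (lemma \<open>expectation_ratio_le\<close>).
  Chebyshev's inequality would not suffice on that event: it gives probability \<open>O(1 / \<kappa>)\<close>, while
  the quotient may be of order \<open>\<kappa>\<close>. The Laplace bound also yields \<open>P(N > 0) \<rightarrow> 1\<close>.
\<close>

section \<open>Riemann sums\<close>

lemma left_Riemann_sum_tendsto_integral:
  fixes f :: "real \<Rightarrow> real"
  assumes "continuous_on {0..1} f"
  shows "(\<lambda>n. (\<Sum>i<n. f (real i / real n)) / real n) \<longlonglongrightarrow> integral {0..1} f"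
proof (rule LIMSEQ_I)
  fix e :: real assume e: "e > 0"
  have "uniformly_continuous_on {0..1} f"
    using assms by (intro compact_uniformly_continuous) auto
  then obtain d where d: "d > 0"
    and unif: "\<And>x y. \<lbrakk>x \<in> {0..1}; y \<in> {0..1}; dist y x < d\<rbrakk> \<Longrightarrow> dist (f y) (f x) < e / 2"
    unfolding uniformly_continuous_on_def using e by (metis half_gt_zero)
  obtain N where N: "N > 0" "1 / real N < d"
    using d by (metis nat_approx_posE zero_less_Suc)
  have "norm ((\<Sum>i<n. f (real i / real n)) / real n - integral {0..1} f) < e" if n: "n \<ge> N" for n
  proof -
    define x where "x i = real i / real n" for i
    have n0: "n > 0" using n N by simp
    have "1 / real n \<le> 1 / real N" using n N by (simp add: field_simps)
    then have mesh: "1 / real n < d" using N by simp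
    have x_step: "x (Suc i) = x i + 1 / real n" for i by (simp add: x_def add_divide_distrib)
    have x_mem: "0 \<le> x i" for i by (simp add: x_def)
    have x_le: "x i \<le> 1" if "i \<le> n" for i using that n0 by (simp add: x_def)
    have split: "integral {0..x k} f = (\<Sum>i<k. integral {x i..x (Suc i)} f)" if "k \<le> n" for k
      using that
    proof (induction k)
      case (Suc k)
      have "integral {0..x k} f + integral {x k..x (Suc k)} f = integral {0..x (Suc k)} f"
        using x_le[OF Suc.prems] x_mem[of k]
        by (intro Henstock_Kurzweil_Integration.integral_combine integrable_continuous_real continuous_on_subset[OF assms])
          (auto simp: x_step intro: order_trans)
      then show ?case using Suc by simp
    qed (simp add: x_def)
    have cell: "\<bar>f (x i) / real n - integral {x i..x (Suc i)} f\<bar> \<le> e / 2 * (1 / real n)"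
      if i: "i < n" for i
    proof -
      have sub: "{x i..x (Suc i)} \<subseteq> {0..1}" using x_mem x_le[of "Suc i"] i by auto
      have "norm (integral {x i..x (Suc i)} (\<lambda>t. f (x i) - f t)) \<le> e / 2 * (x (Suc i) - x i)"
      proof (rule integral_bound)
        show "x i \<le> x (Suc i)" by (simp add: x_step)
        show "continuous_on {x i..x (Suc i)} (\<lambda>t. f (x i) - f t)"
          using continuous_on_subset[OF assms sub] by (intro continuous_intros)
        fix t assume t: "t \<in> {x i..x (Suc i)}"
        then have "dist (x i) t < d" using mesh by (auto simp: dist_real_def x_step)
        moreover have "t \<in> {0..1}" "x i \<in> {0..1}" using t sub by (auto simp: x_step)
        ultimately show "norm (f (x i) - f t) \<le> e / 2"
          using unif[of t "x i"] by (simp add: dist_real_def)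
      qed
      moreover have "integral {x i..x (Suc i)} (\<lambda>t. f (x i) - f t) =
          f (x i) / real n - integral {x i..x (Suc i)} f"
        using continuous_on_subset[OF assms sub]
        by (subst Henstock_Kurzweil_Integration.integral_diff)
          (auto intro!: integrable_continuous_real simp: x_step)
      ultimately show ?thesis by (simp add: x_step)
    qed
    have x_n: "x n = 1" using n0 by (simp add: x_def)
    have "\<bar>(\<Sum>i<n. f (x i)) / real n - integral {0..1} f\<bar> =
        \<bar>\<Sum>i<n. f (x i) / real n - integral {x i..x (Suc i)} f\<bar>"
      using split[of n] by (simp add: x_n sum_divide_distrib sum_subtractf)
    also have "\<dots> \<le> (\<Sum>i<n. e / 2 * (1 / real n))"
      by (rule order_trans[OF sum_abs sum_mono]) (use cell in auto)
    also have "\<dots> < e" using n0 e by simp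
    finally show ?thesis by (simp add: x_def)
  qed
  then show "\<exists>no. \<forall>n\<ge>no. norm ((\<Sum>i<n. f (real i / real n)) / real n - integral {0..1} f) < e"
    by blast
qed

section \<open>Variance of a sum of independent variables\<close>

lemma (in prob_space) variance_sum_indep:
  fixes X :: "'i \<Rightarrow> 'a \<Rightarrow> real"
  assumes "finite I" and "indep_vars (\<lambda>_. borel) X I"
    and "\<And>i. i \<in> I \<Longrightarrow> integrable M (X i)"
    and "\<And>i. i \<in> I \<Longrightarrow> integrable M (\<lambda>\<omega>. (X i \<omega>)\<^sup>2)"
  shows "integrable M (\<lambda>\<omega>. (\<Sum>i\<in>I. X i \<omega>)\<^sup>2)"
    and "variance (\<lambda>\<omega>. \<Sum>i\<in>I. X i \<omega>) = (\<Sum>i\<in>I. variance (X i))"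
proof -
  have "integrable M (\<lambda>\<omega>. (\<Sum>i\<in>I. X i \<omega>)\<^sup>2) \<and>
      variance (\<lambda>\<omega>. \<Sum>i\<in>I. X i \<omega>) = (\<Sum>i\<in>I. variance (X i))"
    using assms
  proof (induction I rule: finite_induct)
    case (insert i I)
    let ?T = "\<lambda>\<omega>. \<Sum>i\<in>I. X i \<omega>"
    have ind: "indep_var borel (X i) borel ?T"
      by (rule indep_vars_sum[OF insert.hyps insert.prems(1)])
    have intT: "integrable M ?T" and intX: "integrable M (X i)"
      and intX2: "integrable M (\<lambda>\<omega>. (X i \<omega>)\<^sup>2)"
      using insert.prems by auto
    have IH: "integrable M (\<lambda>\<omega>. (?T \<omega>)\<^sup>2)" "variance ?T = (\<Sum>i\<in>I. variance (X i))"
      using insert.IH[OF indep_vars_subset[OF insert.prems(1)]] insert.prems by auto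
    note cross = indep_var_integrable[OF ind intX intT]
    have sq: "(\<lambda>\<omega>. (X i \<omega> + ?T \<omega>)\<^sup>2) = (\<lambda>\<omega>. (X i \<omega>)\<^sup>2 + 2 * (X i \<omega> * ?T \<omega>) + (?T \<omega>)\<^sup>2)"
      by (simp add: power2_sum mult.assoc fun_eq_iff algebra_simps)
    have int: "integrable M (\<lambda>\<omega>. (X i \<omega> + ?T \<omega>)\<^sup>2)"
      unfolding sq using intX2 cross IH(1) by auto
    have "expectation (\<lambda>\<omega>. (X i \<omega> + ?T \<omega>)\<^sup>2) =
        expectation (\<lambda>\<omega>. (X i \<omega>)\<^sup>2) + 2 * (expectation (X i) * expectation ?T)
          + expectation (\<lambda>\<omega>. (?T \<omega>)\<^sup>2)"
      unfolding sq using intX2 cross IH(1) indep_var_lebesgue_integral[OF ind intX intT] by simp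
    moreover have "expectation (\<lambda>\<omega>. X i \<omega> + ?T \<omega>) = expectation (X i) + expectation ?T"
      using intX intT by (rule Bochner_Integration.integral_add)
    ultimately have "variance (\<lambda>\<omega>. X i \<omega> + ?T \<omega>) = variance (X i) + variance ?T"
      unfolding variance_eq[OF Bochner_Integration.integrable_add[OF intX intT] int]
        variance_eq[OF intX intX2] variance_eq[OF intT IH(1)]
      by (simp only:) (simp add: power2_sum)
    then show ?case using int IH(2) insert.hyps by simp
  qed simp
  then show "integrable M (\<lambda>\<omega>. (\<Sum>i\<in>I. X i \<omega>)\<^sup>2)"
    and "variance (\<lambda>\<omega>. \<Sum>i\<in>I. X i \<omega>) = (\<Sum>i\<in>I. variance (X i))"
    by simp_all
qed

section \<open>Points over a single grid point\<close>

lemma Theta_eq_image: "Theta n = (\<lambda>i. real i / real n) ` {..<n}"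
  by (auto simp: Theta_def)

lemma finite_Theta: "finite (Theta n)"
  by (simp add: Theta_eq_image)

lemma sum_Theta: "(\<Sum>\<theta>\<in>Theta n. f \<theta>) = (\<Sum>i<n. f (real i / real n))"
proof -
  have "inj_on (\<lambda>i. real i / real n) {..<n}"
    by (auto simp: inj_on_def)
  then show ?thesis by (simp add: Theta_eq_image sum.reindex)
qed

lemma card_Theta: "card (Theta n) = n"
  using sum_Theta[of "\<lambda>_. 1::nat" n] by simp

context original_space
begin

lemma random_U [measurable]: "\<theta> \<in> Theta n \<Longrightarrow> random_variable (count_space UNIV) (U \<theta>)"
  and random_Y [measurable]: "\<theta> \<in> Theta n \<Longrightarrow> random_variable (count_space UNIV) (Y \<theta>)"
proof -
  have rv: "random_variable (count_space UNIV) (case_sum U Y i)" if "i \<in> Theta n <+> Theta n" for i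
    using mutually_indep that unfolding indep_vars_def2 by blast
  show "\<theta> \<in> Theta n \<Longrightarrow> random_variable (count_space UNIV) (U \<theta>)"
    and "\<theta> \<in> Theta n \<Longrightarrow> random_variable (count_space UNIV) (Y \<theta>)"
    using rv[OF InlI] rv[OF InrI] by force+
qed

text \<open>The family \<open>g\<close> may depend on the site: letting it differ at one \<open>\<theta>\<close> only is how the
  activity at \<open>\<theta>\<close> is separated from the points over all other sites in \<open>indep_act_rest\<close>.\<close>

lemma indep_sites:
  fixes g :: "real \<Rightarrow> nat \<Rightarrow> nat \<Rightarrow> real"
  shows "indep_vars (\<lambda>_. borel) (\<lambda>\<theta> \<omega>. g \<theta> (U \<theta> \<omega>) (Y \<theta> \<omega>)) (Theta n)"
proof -
  define J :: "real \<Rightarrow> (real + real) set" where "J \<theta> = {Inl \<theta>, Inr \<theta>}" for \<theta>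
  have "indep_vars (\<lambda>\<theta>. PiM (J \<theta>) (\<lambda>_. count_space UNIV))
      (\<lambda>\<theta> \<omega>. restrict (\<lambda>i. case_sum U Y i \<omega>) (J \<theta>)) (Theta n)"
    by (rule indep_vars_restrict[OF mutually_indep]) (auto simp: J_def disjoint_family_on_def)
  then have "indep_vars (\<lambda>_. borel)
      (\<lambda>\<theta> \<omega>. (\<lambda>h. g \<theta> (h (Inl \<theta>)) (h (Inr \<theta>))) (restrict (\<lambda>i. case_sum U Y i \<omega>) (J \<theta>))) (Theta n)"
  proof (rule indep_vars_compose2)
    fix \<theta>
    have [measurable]: "(\<lambda>h. h i) \<in> measurable (PiM (J \<theta>) (\<lambda>_. count_space UNIV)) (count_space UNIV)"
      if "i \<in> J \<theta>" for i
      using that by (rule measurable_component_singleton)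
    have [measurable]: "Inl \<theta> \<in> J \<theta>" "Inr \<theta> \<in> J \<theta>" by (auto simp: J_def)
    show "(\<lambda>h. g \<theta> (h (Inl \<theta>)) (h (Inr \<theta>))) \<in>
        borel_measurable (PiM (J \<theta>) (\<lambda>_. count_space (UNIV :: nat set)))"
      by measurable
  qed
  then show ?thesis by (simp add: J_def)
qed

lemma integrable_site:
  fixes h :: "nat \<Rightarrow> nat \<Rightarrow> real"
  assumes \<theta>: "\<theta> \<in> Theta n" and bd: "\<And>u y. y \<le> n0 \<Longrightarrow> \<bar>h u y\<bar> \<le> C"
  shows "integrable PO (\<lambda>\<omega>. h (U \<theta> \<omega>) (Y \<theta> \<omega>))"
proof (rule integrable_const_bound)
  note [measurable] = \<theta>
  show "AE \<omega> in PO. norm (h (U \<theta> \<omega>) (Y \<theta> \<omega>)) \<le> C"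
    using Y_range[OF \<theta>] by (intro AE_I2) (auto intro!: bd)
  show "random_variable borel (\<lambda>\<omega>. h (U \<theta> \<omega>) (Y \<theta> \<omega>))" by measurable
qed

text \<open>The indicator of \<open>U\<^sub>\<theta> = 1\<close> replaces \<open>U\<^sub>\<theta>\<close> itself, which takes values in \<open>{0, 1}\<close> only
  almost surely. Thus \<open>W\<^sub>\<theta>\<close> counts the points over \<open>\<theta>\<close> at every point of the sample space,
  without exceptional null sets.\<close>

definition act :: "real \<Rightarrow> 'w \<Rightarrow> real" where
  "act \<theta> \<omega> = of_bool (U \<theta> \<omega> = 1)"

definition W :: "real \<Rightarrow> 'w \<Rightarrow> real" where
  "W \<theta> \<omega> = of_bool (U \<theta> \<omega> = 1) * real (Y \<theta> \<omega>)"

abbreviation "p \<equiv> \<kappa> / real n"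

lemma p_range: "0 < p" "p < 1"
  using kappa_range n_ge_2 by (auto simp: field_simps)

lemma expectation_act:
  assumes \<theta>: "\<theta> \<in> Theta n"
  shows "expectation (act \<theta>) = p"
proof -
  note [measurable] = \<theta>
  have "expectation (act \<theta>) = expectation (indicator {\<omega> \<in> space PO. U \<theta> \<omega> = 1})"
    by (intro Bochner_Integration.integral_cong) (auto simp: act_def indicator_def)
  also have "\<dots> = prob {\<omega> \<in> space PO. U \<theta> \<omega> = 1}" by simp
  also have "\<dots> = measure (distr PO (count_space UNIV) (U \<theta>)) {1}"
    by (subst measure_distr) (auto intro!: arg_cong[where f=prob])
  also have "\<dots> = measure (measure_pmf (bernoulli_pmf p)) (of_bool -` {1::nat})"
    by (simp add: U_bernoulli[OF \<theta>])
  also have "of_bool -` {1::nat} = {True}" by (auto simp: of_bool_def split: if_splits)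
  also have "measure (measure_pmf (bernoulli_pmf p)) {True} = p"
    using p_range by (simp add: measure_pmf_single)
  finally show ?thesis .
qed

lemma indep_UY:
  assumes \<theta>: "\<theta> \<in> Theta n"
  shows "indep_var borel (act \<theta>) borel (\<lambda>\<omega>. real (Y \<theta> \<omega>))"
proof -
  have "indep_var borel ((\<lambda>h. of_bool (h (Inl \<theta>) = 1)) \<circ> (\<lambda>\<omega>. restrict (\<lambda>i. case_sum U Y i \<omega>) {Inl \<theta>}))
      borel ((\<lambda>h. real (h (Inr \<theta>))) \<circ> (\<lambda>\<omega>. restrict (\<lambda>i. case_sum U Y i \<omega>) {Inr \<theta>}))"
  proof (rule indep_var_compose[OF indep_var_restrict[OF mutually_indep]])
    show "(\<lambda>h. of_bool (h (Inl \<theta>) = (1::nat)) :: real) \<in>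
        borel_measurable (PiM {Inl \<theta>} (\<lambda>_. count_space UNIV))"
      by (rule measurable_compose[OF measurable_component_singleton[of "Inl \<theta>"]]) auto
    show "(\<lambda>h. real (h (Inr \<theta>))) \<in>
        borel_measurable (PiM {Inr \<theta>} (\<lambda>_. count_space UNIV))"
      by (rule measurable_compose[OF measurable_component_singleton[of "Inr \<theta>"]]) auto
  qed (use \<theta> in auto)
  then show ?thesis by (simp add: comp_def act_def[abs_def])
qed

lemma integrable_act: "\<theta> \<in> Theta n \<Longrightarrow> integrable PO (act \<theta>)"
  unfolding act_def[abs_def] by (rule integrable_site[where C=1]) auto

lemma W_bounds: "\<theta> \<in> Theta n \<Longrightarrow> \<omega> \<in> space PO \<Longrightarrow> 0 \<le> W \<theta> \<omega> \<and> W \<theta> \<omega> \<le> real n0 * act \<theta> \<omega>"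
  using Y_range[of \<theta> \<omega>] by (auto simp: W_def act_def)

lemma integrable_W: "\<theta> \<in> Theta n \<Longrightarrow> integrable PO (W \<theta>)"
  unfolding W_def[abs_def] by (rule integrable_site[where C="real n0"]) auto

lemma expectation_W:
  assumes \<theta>: "\<theta> \<in> Theta n"
  shows "expectation (W \<theta>) = p * m \<theta>"
proof -
  have "expectation (\<lambda>\<omega>. act \<theta> \<omega> * real (Y \<theta> \<omega>)) = expectation (act \<theta>) * expectation (\<lambda>\<omega>. real (Y \<theta> \<omega>))"
  proof (rule indep_var_lebesgue_integral[OF indep_UY[OF \<theta>]])
    show "integrable PO (\<lambda>\<omega>. real (Y \<theta> \<omega>))"
      by (rule integrable_site[OF \<theta>, where C="real n0"]) auto
  qed (rule integrable_act[OF \<theta>])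
  then show ?thesis
    unfolding W_def[abs_def] act_def[symmetric] by (simp add: expectation_act[OF \<theta>] Y_mean[OF \<theta>])
qed

lemma AE_Y_pos: "\<theta> \<in> Theta n \<Longrightarrow> AE \<omega> in PO. 1 \<le> Y \<theta> \<omega>"
proof -
  assume \<theta>: "\<theta> \<in> Theta n"
  note [measurable] = \<theta>
  have "AE \<omega> in PO. Y \<theta> \<omega> \<noteq> 0"
    using Y_nonzero[OF \<theta>] by (subst AE_iff_measurable[OF _ refl]) (auto simp: emeasure_eq_measure)
  then show ?thesis by (rule AE_mp) (auto intro!: AE_I2)
qed

text \<open>The lower bound makes every \<open>M\<^sub>n\<close>, and so the limiting integral, at least 1; it comes from
  \<open>Y\<^sub>\<theta>\<close> being almost surely nonzero.\<close>

lemma m_bounds: assumes \<theta>: "\<theta> \<in> Theta n" shows "1 \<le> m \<theta>" "m \<theta> \<le> real n0"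
proof -
  have int: "integrable PO (\<lambda>\<omega>. real (Y \<theta> \<omega>))"
    by (rule integrable_site[OF \<theta>, where C="real n0"]) auto
  have "expectation (\<lambda>_. 1) \<le> expectation (\<lambda>\<omega>. real (Y \<theta> \<omega>))"
    using AE_Y_pos[OF \<theta>] int by (intro integral_mono_AE) auto
  then show "1 \<le> m \<theta>" by (simp add: Y_mean[OF \<theta>] prob_space)
  have "expectation (\<lambda>\<omega>. real (Y \<theta> \<omega>)) \<le> expectation (\<lambda>_. real n0)"
    using Y_range[OF \<theta>] int by (intro integral_mono_AE) auto
  then show "m \<theta> \<le> real n0" by (simp add: Y_mean[OF \<theta>] prob_space)
qed

section \<open>The total number of points\<close>

text \<open>The expectation of \<open>pop\<close>, in the explicit form used for all estimates.\<close>

definition mean_pop :: real where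
  "mean_pop = (\<Sum>\<theta>\<in>Theta n. p * m \<theta>)"

definition pop :: "'w \<Rightarrow> real" where
  "pop \<omega> = (\<Sum>\<theta>\<in>Theta n. W \<theta> \<omega>)"

definition rest :: "real \<Rightarrow> 'w \<Rightarrow> real" where
  "rest \<theta> \<omega> = (\<Sum>j\<in>Theta n - {\<theta>}. W j \<omega>)"

lemma pop_eq: "\<theta> \<in> Theta n \<Longrightarrow> pop \<omega> = W \<theta> \<omega> + rest \<theta> \<omega>"
  unfolding pop_def rest_def by (rule sum.remove[OF finite_Theta])

lemma rest_nonneg: "\<omega> \<in> space PO \<Longrightarrow> 0 \<le> rest \<theta> \<omega>"
  unfolding rest_def using W_bounds by (intro sum_nonneg) auto

lemma integrable_rest: "integrable PO (rest \<theta>)"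
  unfolding rest_def using integrable_W by auto

lemma sum_fibre_XX:
  assumes "\<theta> \<in> Theta n" "\<omega> \<in> space PO"
  shows "(\<Sum>k\<in>{0..n0}. indicator (XX \<omega>) (\<theta>, k)) = W \<theta> \<omega>"
proof -
  have "(\<Sum>k\<in>{0..n0}. indicator (XX \<omega>) (\<theta>, k)) = (\<Sum>k\<in>{1..Y \<theta> \<omega>}. of_bool (U \<theta> \<omega> = 1) :: real)"
    using assms Y_range[OF assms]
    by (intro sum.mono_neutral_cong_right) (auto simp: XO_def K_def indicator_def)
  then show ?thesis by (simp add: W_def)
qed

lemma card_XX_eq_pop: "\<omega> \<in> space PO \<Longrightarrow> real (card (XX \<omega>)) = pop \<omega>"
  unfolding card_XX K_def pop_def
  by (subst sum.cartesian_product[symmetric, where g="\<lambda>\<theta> k. indicator (XX _) (\<theta>, k)", simplified])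
    (auto intro!: sum.cong sum_fibre_XX)

lemma mean_pop_bounds: "\<kappa> \<le> mean_pop" "mean_pop \<le> real n0 * \<kappa>"
proof -
  have "(\<Sum>\<theta>\<in>Theta n. p * 1) \<le> mean_pop"
    unfolding mean_pop_def using m_bounds(1) p_range by (intro sum_mono mult_left_mono) auto
  then show "\<kappa> \<le> mean_pop" using n_ge_2 by (simp add: card_Theta)
  have "mean_pop \<le> (\<Sum>\<theta>\<in>Theta n. p * real n0)"
    unfolding mean_pop_def using m_bounds(2) p_range by (intro sum_mono mult_left_mono) auto
  then show "mean_pop \<le> real n0 * \<kappa>" using n_ge_2 by (simp add: card_Theta mult.commute)
qed

lemma expectation_rest:
  assumes "\<theta> \<in> Theta n"
  shows "expectation (rest \<theta>) = mean_pop - p * m \<theta>"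
proof -
  have "expectation (rest \<theta>) = (\<Sum>j\<in>Theta n - {\<theta>}. p * m j)"
    unfolding rest_def
    by (subst Bochner_Integration.integral_sum) (auto simp: integrable_W expectation_W)
  then show ?thesis
    unfolding mean_pop_def using sum.remove[OF finite_Theta assms, of "\<lambda>j. p * m j"] by simp
qed

lemma indep_W: "indep_vars (\<lambda>_. borel) W (Theta n)"
  using indep_sites[of "\<lambda>_ u y. of_bool (u = 1) * real y"] by (simp add: W_def[abs_def])

lemma
  shows integrable_rest_sq: "integrable PO (\<lambda>\<omega>. (rest \<theta> \<omega>)\<^sup>2)"
    and variance_rest: "variance (rest \<theta>) \<le> (real n0)\<^sup>2 * \<kappa>"
proof -
  have ind: "indep_vars (\<lambda>_. borel) W (Theta n - {\<theta>})"
    by (rule indep_vars_subset[OF indep_W]) auto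
  have int2: "integrable PO (\<lambda>\<omega>. (W j \<omega>)\<^sup>2)" if "j \<in> Theta n" for j
    unfolding W_def using that
    by (rule integrable_site[where C="(real n0)\<^sup>2"]) (auto simp: abs_square_le_1 power_mult_distrib)
  note sum = variance_sum_indep[OF _ ind integrable_W int2]
  show "integrable PO (\<lambda>\<omega>. (rest \<theta> \<omega>)\<^sup>2)"
    unfolding rest_def using finite_Theta by (intro sum(1)) auto
  have var: "variance (W j) \<le> (real n0)\<^sup>2 * p" if j: "j \<in> Theta n" for j
  proof -
    have "variance (W j) \<le> expectation (\<lambda>\<omega>. (W j \<omega>)\<^sup>2)"
      by (simp add: variance_eq[OF integrable_W[OF j] int2[OF j]])
    also have "\<dots> \<le> expectation (\<lambda>\<omega>. (real n0)\<^sup>2 * act j \<omega>)"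
    proof (intro integral_mono integrable_mult_right integrable_act int2 j)
      fix \<omega> assume \<omega>: "\<omega> \<in> space PO"
      have "(W j \<omega>)\<^sup>2 \<le> (real n0 * act j \<omega>)\<^sup>2"
        using W_bounds[OF j \<omega>] by (intro power_mono) auto
      then show "(W j \<omega>)\<^sup>2 \<le> (real n0)\<^sup>2 * act j \<omega>"
        by (auto simp: power_mult_distrib act_def)
    qed
    finally show ?thesis by (simp add: expectation_act[OF j])
  qed
  have "variance (rest \<theta>) = (\<Sum>j\<in>Theta n - {\<theta>}. variance (W j))"
    unfolding rest_def[abs_def] using finite_Theta by (intro sum(2)) auto
  also have "\<dots> \<le> (\<Sum>j\<in>Theta n - {\<theta>}. (real n0)\<^sup>2 * p)"
    using var by (intro sum_mono) auto
  also have "\<dots> \<le> (\<Sum>j\<in>Theta n. (real n0)\<^sup>2 * p)"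
    using kappa_range finite_Theta by (intro sum_mono2) auto
  also have "\<dots> = (real n0)\<^sup>2 * \<kappa>" using n_ge_2 by (simp add: card_Theta)
  finally show "variance (rest \<theta>) \<le> (real n0)\<^sup>2 * \<kappa>" .
qed

text \<open>The deviation is taken from the mean of the whole population rather than of the rest, so that
  the main term of the comparison is exactly \<open>n \<pi>\<^sub>E(\<theta>)\<close>; the bias \<open>p m(\<theta>) \<le> n\<^sub>0\<close> accounts for the
  summand 1.\<close>

lemma second_moment_rest:
  assumes \<theta>: "\<theta> \<in> Theta n"
  shows "expectation (\<lambda>\<omega>. (mean_pop - rest \<theta> \<omega>)\<^sup>2) \<le> (real n0)\<^sup>2 * (\<kappa> + 1)"
proof -
  have "expectation (\<lambda>\<omega>. (mean_pop - rest \<theta> \<omega>)\<^sup>2) =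
      mean_pop\<^sup>2 - 2 * mean_pop * expectation (rest \<theta>) + expectation (\<lambda>\<omega>. (rest \<theta> \<omega>)\<^sup>2)"
    using integrable_rest integrable_rest_sq by (simp add: power2_diff prob_space)
  also have "\<dots> = variance (rest \<theta>) + (p * m \<theta>)\<^sup>2"
    unfolding variance_eq[OF integrable_rest integrable_rest_sq]
    unfolding expectation_rest[OF \<theta>]
    by (simp add: power2_eq_square algebra_simps)
  also have "(p * m \<theta>)\<^sup>2 \<le> (1 * real n0)\<^sup>2"
    using p_range m_bounds[OF \<theta>] kappa_range by (intro power_mono mult_mono) auto
  finally show ?thesis using variance_rest[of \<theta>] by (simp add: algebra_simps)
qed

text \<open>Almost surely an active site contributes at least one point, and \<open>exp(- 1) \<le> 1 / 2\<close>, so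
  each of the \<open>n - 1\<close> independent factors has mean at most \<open>1 - p / 2 \<le> exp(- p / 2)\<close>. Passing to \<open>\<kappa> / 4\<close> uses \<open>n - 1 \<ge> n / 2\<close>.\<close>

lemma
  assumes \<theta>: "\<theta> \<in> Theta n"
  shows integrable_exp_rest: "integrable PO (\<lambda>\<omega>. exp (- rest \<theta> \<omega>))"
    and Laplace_rest: "expectation (\<lambda>\<omega>. exp (- rest \<theta> \<omega>)) \<le> exp (- \<kappa> / 4)"
proof -
  let ?I = "Theta n - {\<theta>}"
  have ind: "indep_vars (\<lambda>_. borel) (\<lambda>j \<omega>. exp (- W j \<omega>)) ?I"
    by (rule indep_vars_subset[OF indep_vars_compose2[OF indep_W, where Y="\<lambda>_ x. exp (- x)"]]) auto
  have prod: "exp (- rest \<theta> \<omega>) = (\<Prod>j\<in>?I. exp (- W j \<omega>))" for \<omega>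
    unfolding rest_def by (simp add: exp_sum finite_Theta flip: sum_negf)
  have int: "integrable PO (\<lambda>\<omega>. exp (- W j \<omega>))" if "j \<in> Theta n" for j
    unfolding W_def using that by (rule integrable_site[where C=1]) auto
  show "integrable PO (\<lambda>\<omega>. exp (- rest \<theta> \<omega>))"
    unfolding prod using finite_Theta ind int by (intro indep_vars_integrable) auto
  have site: "expectation (\<lambda>\<omega>. exp (- W j \<omega>)) \<le> exp (- p / 2)" if j: "j \<in> Theta n" for j
  proof -
    have "expectation (\<lambda>\<omega>. exp (- W j \<omega>)) \<le> expectation (\<lambda>\<omega>. 1 - act j \<omega> / 2)"
    proof (rule integral_mono_AE)
      show "AE \<omega> in PO. exp (- W j \<omega>) \<le> 1 - act j \<omega> / 2"
        using AE_Y_pos[OF j]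
      proof eventually_elim
        case (elim \<omega>)
        have "exp (- real (Y j \<omega>)) \<le> exp (- 1)" using elim by simp
        also have "\<dots> \<le> (1 / 2 :: real)"
          using exp_ge_add_one_self[of "1::real"] by (simp add: exp_minus field_simps)
        finally show ?case by (simp add: W_def act_def)
      qed
    qed (use int integrable_act j in auto)
    also have "\<dots> = 1 - p / 2"
      using integrable_act[OF j] by (simp add: expectation_act[OF j] prob_space)
    also have "\<dots> \<le> exp (- p / 2)"
      using exp_ge_add_one_self[of "- p / 2"] by simp
    finally show ?thesis .
  qed
  have "expectation (\<lambda>\<omega>. exp (- rest \<theta> \<omega>)) = (\<Prod>j\<in>?I. expectation (\<lambda>\<omega>. exp (- W j \<omega>)))"
    unfolding prod using finite_Theta ind int by (intro indep_vars_lebesgue_integral) auto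
  also have "\<dots> \<le> (\<Prod>j\<in>?I. exp (- p / 2))"
    using site by (intro prod_mono) auto
  also have "\<dots> = exp (real (n - 1) * (- p / 2))"
    by (simp only: prod_constant card_Diff_singleton[OF \<theta>] card_Theta exp_of_nat_mult)
  also have "\<dots> \<le> exp (- \<kappa> / 4)"
  proof -
    have "n * \<kappa> \<le> 2 * real (n - 1) * \<kappa>"
      using n_ge_2 kappa_range by (intro mult_right_mono) auto
    then show ?thesis using n_ge_2 by (simp add: field_simps)
  qed
  finally show "expectation (\<lambda>\<omega>. exp (- rest \<theta> \<omega>)) \<le> exp (- \<kappa> / 4)" .
qed

text \<open>If the random set is empty then in particular no points lie outside the fibre of 0, and
  the exponential of the negated count is 1, so its mean bounds the probability.\<close>

lemma prob_XX_nonempty_ge: "1 - exp (- \<kappa> / 4) \<le> prob {\<omega> \<in> space PO. XX \<omega> \<noteq> {}}"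
proof -
  have \<theta>: "0 \<in> Theta n" using n_ge_2 by (auto simp: Theta_def intro!: exI[of _ 0])
  have "expectation (\<lambda>\<omega>. 1 - exp (- rest 0 \<omega>)) \<le>
      expectation (indicator {\<omega> \<in> space PO. XX \<omega> \<noteq> {}})"
  proof (rule integral_mono)
    fix \<omega> assume \<omega>: "\<omega> \<in> space PO"
    have "rest 0 \<omega> = 0" if "XX \<omega> = {}"
      using card_XX_eq_pop[OF \<omega>] W_bounds[OF \<theta> \<omega>] rest_nonneg[OF \<omega>, of 0] that
      by (simp add: pop_eq[OF \<theta>])
    then show "1 - exp (- rest 0 \<omega>) \<le> indicator {\<omega> \<in> space PO. XX \<omega> \<noteq> {}} \<omega>"
      using \<omega> by (auto simp: indicator_def)
  next
    have "{\<omega> \<in> space PO. XX \<omega> \<noteq> {}} \<in> events" by measurable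
    then show "integrable PO (indicat_real {\<omega> \<in> space PO. XX \<omega> \<noteq> {}})"
      by (simp add: emeasure_eq_measure)
  qed (use integrable_exp_rest[OF \<theta>] in auto)
  then show ?thesis
    using Laplace_rest[OF \<theta>] integrable_exp_rest[OF \<theta>] by (simp add: prob_space)
qed

end

section \<open>Replacing the number of points by its mean\<close>

text \<open>The two summands bound the contributions of the events \<open>R \<ge> \<kappa> / 8\<close> and \<open>R < \<kappa> / 8\<close> to the
  mean of the quotient \<open>(|\<mu> - R| + n\<^sub>0) / (1 + R)\<close>, where \<open>R\<close> counts the points outside one
  fibre.\<close>

definition ratio_bound :: "nat \<Rightarrow> real \<Rightarrow> real" where
  "ratio_bound n0 \<kappa> =
     8 / \<kappa> * (((real n0)\<^sup>2 * (\<kappa> + 1) / sqrt \<kappa> + sqrt \<kappa>) / 2 + real n0)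
     + (real n0 * \<kappa> + \<kappa> + real n0) * exp (- \<kappa> / 8)"

lemma ratio_bound_tendsto_0: "(ratio_bound n0 \<longlongrightarrow> 0) at_top"
  unfolding ratio_bound_def by real_asymp

context original_space
begin

definition ratio :: "real \<Rightarrow> 'w \<Rightarrow> real" where
  "ratio \<theta> \<omega> = (\<bar>mean_pop - rest \<theta> \<omega>\<bar> + real n0) / (1 + rest \<theta> \<omega>)"

text \<open>The dominating function \<open>h\<close> below is linear in \<open>(\<mu> - R)\<^sup>2\<close> and \<open>exp(- R)\<close>, whose means
  are already bounded. Its first part covers \<open>R \<ge> \<kappa> / 8\<close>; the second is at least the trivial bound
  \<open>n\<^sub>0 \<kappa> + \<kappa> + n\<^sub>0\<close> when \<open>R < \<kappa> / 8\<close>, and the threshold is below the exponent \<open>\<kappa> / 4\<close> of the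
  Laplace bound, so exponential decay survives.\<close>

lemma
  assumes \<theta>: "\<theta> \<in> Theta n"
  shows integrable_ratio: "integrable PO (ratio \<theta>)"
    and expectation_ratio_le: "expectation (ratio \<theta>) \<le> ratio_bound n0 \<kappa>"
proof -
  let ?s = "sqrt \<kappa>" and ?C = "real n0 * \<kappa> + \<kappa> + real n0"
  define h where "h \<omega> = 8 / \<kappa> * (((mean_pop - rest \<theta> \<omega>)\<^sup>2 / ?s + ?s) / 2 + real n0)
      + ?C * exp (\<kappa> / 8) * exp (- rest \<theta> \<omega>)" for \<omega>
  have \<kappa>: "\<kappa> > 0" using kappa_range by simp
  have s: "?s > 0" using \<kappa> by simp
  have int_sq: "integrable PO (\<lambda>\<omega>. (mean_pop - rest \<theta> \<omega>)\<^sup>2)"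
    using integrable_rest integrable_rest_sq by (simp add: power2_diff)
  have int_h: "integrable PO h"
    unfolding h_def using int_sq integrable_exp_rest[OF \<theta>] by auto
  have nonneg: "0 \<le> ratio \<theta> \<omega>" if "\<omega> \<in> space PO" for \<omega>
    using rest_nonneg[OF that, of \<theta>] by (simp add: ratio_def)
  have le: "ratio \<theta> \<omega> \<le> h \<omega>" if \<omega>: "\<omega> \<in> space PO" for \<omega>
  proof -
    let ?R = "rest \<theta> \<omega>" and ?x = "\<bar>mean_pop - rest \<theta> \<omega>\<bar>"
    have R: "0 \<le> ?R" by (rule rest_nonneg[OF \<omega>])
    \<comment> \<open>The weight \<open>sqrt \<kappa>\<close>, the order of the standard deviation, balances both terms.\<close>
    have "0 \<le> (?x - ?s)\<^sup>2" by simp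
    then have "2 * ?x * ?s \<le> (mean_pop - ?R)\<^sup>2 + ?s\<^sup>2" by (simp add: power2_diff)
    then have am_gm: "?x \<le> ((mean_pop - ?R)\<^sup>2 / ?s + ?s) / 2"
      using s by (simp add: field_simps power2_eq_square)
    show ?thesis
    proof (cases "\<kappa> / 8 \<le> ?R")
      case True
      have "ratio \<theta> \<omega> \<le> (?x + real n0) / (\<kappa> / 8)"
        unfolding ratio_def using True \<kappa> by (intro divide_left_mono) auto
      also have "\<dots> = 8 / \<kappa> * (?x + real n0)" by simp
      also have "\<dots> \<le> 8 / \<kappa> * (((mean_pop - ?R)\<^sup>2 / ?s + ?s) / 2 + real n0)"
        using am_gm \<kappa> by (intro mult_left_mono) auto
      also have "\<dots> \<le> h \<omega>" using \<kappa> by (simp add: h_def)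
      finally show ?thesis .
    next
      case False
      have "ratio \<theta> \<omega> \<le> (?x + real n0) / 1"
        unfolding ratio_def using R by (intro divide_left_mono) auto
      also have "\<dots> \<le> ?C" using False R \<kappa> mean_pop_bounds by auto
      also have "\<dots> = ?C * 1" by simp
      also have "\<dots> \<le> ?C * exp (\<kappa> / 8 - ?R)" using False \<kappa> by (intro mult_left_mono) auto
      also have "\<dots> = ?C * exp (\<kappa> / 8) * exp (- ?R)"
        by (simp only: mult.assoc exp_add[symmetric] diff_conv_add_uminus)
      also have "\<dots> \<le> h \<omega>" using \<kappa> s by (simp add: h_def)
      finally show ?thesis .
    qed
  qed
  have [measurable]: "random_variable borel (rest \<theta>)" using integrable_rest by auto
  show int: "integrable PO (ratio \<theta>)"
  proof (rule Bochner_Integration.integrable_bound[OF int_h])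
    show "random_variable borel (ratio \<theta>)" unfolding ratio_def[abs_def] by measurable
    show "AE \<omega> in PO. norm (ratio \<theta> \<omega>) \<le> norm (h \<omega>)"
      using le nonneg by (intro AE_I2) force
  qed
  have "expectation (ratio \<theta>) \<le> expectation h"
    using le by (intro integral_mono int int_h) auto
  also have "\<dots> = 8 / \<kappa> * ((expectation (\<lambda>\<omega>. (mean_pop - rest \<theta> \<omega>)\<^sup>2) / ?s + ?s) / 2 + real n0)
      + ?C * exp (\<kappa> / 8) * expectation (\<lambda>\<omega>. exp (- rest \<theta> \<omega>))"
    unfolding h_def using int_sq integrable_exp_rest[OF \<theta>] by (simp add: prob_space)
  also have "\<dots> \<le> 8 / \<kappa> * (((real n0)\<^sup>2 * (\<kappa> + 1) / ?s + ?s) / 2 + real n0)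
      + ?C * exp (\<kappa> / 8) * exp (- \<kappa> / 4)"
    using \<kappa> s second_moment_rest[OF \<theta>] Laplace_rest[OF \<theta>]
    by (intro add_mono mult_left_mono divide_right_mono order_refl) auto
  also have "\<dots> = ratio_bound n0 \<kappa>"
    by (simp add: ratio_bound_def mult.assoc flip: exp_add)
  finally show "expectation (ratio \<theta>) \<le> ratio_bound n0 \<kappa>" .
qed

lemma indep_act_rest:
  assumes \<theta>: "\<theta> \<in> Theta n"
  shows "indep_var borel (act \<theta>) borel (rest \<theta>)"
proof -
  define g :: "real \<Rightarrow> nat \<Rightarrow> nat \<Rightarrow> real"
    where "g j u y = (if j = \<theta> then of_bool (u = 1) else of_bool (u = 1) * real y)" for j u y
  have "indep_vars (\<lambda>_. borel) (\<lambda>j \<omega>. g j (U j \<omega>) (Y j \<omega>)) (insert \<theta> (Theta n - {\<theta>}))"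
    using indep_sites[of g] \<theta> by (simp add: insert_absorb)
  then have "indep_var borel (\<lambda>\<omega>. g \<theta> (U \<theta> \<omega>) (Y \<theta> \<omega>))
      borel (\<lambda>\<omega>. \<Sum>j\<in>Theta n - {\<theta>}. g j (U j \<omega>) (Y j \<omega>))"
    using finite_Theta by (intro indep_vars_sum) auto
  moreover have "(\<lambda>\<omega>. g \<theta> (U \<theta> \<omega>) (Y \<theta> \<omega>)) = act \<theta>"
    by (simp add: g_def act_def fun_eq_iff)
  moreover have "(\<lambda>\<omega>. \<Sum>j\<in>Theta n - {\<theta>}. g j (U j \<omega>) (Y j \<omega>)) = rest \<theta>"
    by (auto simp: g_def rest_def W_def fun_eq_iff intro!: sum.cong)
  ultimately show ?thesis by simp
qed

lemma
  assumes \<theta>: "\<theta> \<in> Theta n"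
  shows integrable_act_ratio: "integrable PO (\<lambda>\<omega>. act \<theta> \<omega> * ratio \<theta> \<omega>)"
    and expectation_act_ratio: "expectation (\<lambda>\<omega>. act \<theta> \<omega> * ratio \<theta> \<omega>) = p * expectation (ratio \<theta>)"
proof -
  let ?f = "\<lambda>r. (\<bar>mean_pop - r\<bar> + real n0) / (1 + r)"
  have "indep_var borel ((\<lambda>x. x) \<circ> act \<theta>) borel (?f \<circ> rest \<theta>)"
    by (rule indep_var_compose[OF indep_act_rest[OF \<theta>]]) auto
  then have ind: "indep_var borel (act \<theta>) borel (ratio \<theta>)"
    by (simp add: comp_def ratio_def[abs_def])
  note * = integrable_act[OF \<theta>] integrable_ratio[OF \<theta>]
  show "integrable PO (\<lambda>\<omega>. act \<theta> \<omega> * ratio \<theta> \<omega>)"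
    by (rule indep_var_integrable[OF ind *])
  show "expectation (\<lambda>\<omega>. act \<theta> \<omega> * ratio \<theta> \<omega>) = p * expectation (ratio \<theta>)"
    using indep_var_lebesgue_integral[OF ind *] by (simp add: expectation_act[OF \<theta>])
qed

lemma integrable_share:
  assumes \<theta>: "\<theta> \<in> Theta n"
  shows "integrable PO (\<lambda>\<omega>. W \<theta> \<omega> / pop \<omega>)"
proof (rule integrable_const_bound)
  have [measurable]: "random_variable borel (W j)" if "j \<in> Theta n" for j
    using integrable_W[OF that] by auto
  note [measurable] = \<theta>
  show "random_variable borel (\<lambda>\<omega>. W \<theta> \<omega> / pop \<omega>)"
    unfolding pop_def[abs_def] by measurable
  show "AE \<omega> in PO. norm (W \<theta> \<omega> / pop \<omega>) \<le> 1"
  proof (rule AE_I2)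
    fix \<omega> assume \<omega>: "\<omega> \<in> space PO"
    have "0 \<le> W \<theta> \<omega>" "W \<theta> \<omega> \<le> pop \<omega>"
      using W_bounds[OF \<theta> \<omega>] rest_nonneg[OF \<omega>, of \<theta>] by (auto simp: pop_eq[OF \<theta>])
    then show "norm (W \<theta> \<omega> / pop \<omega>) \<le> 1" by (cases "pop \<omega> = 0") (auto simp: divide_le_eq_1)
  qed
qed

text \<open>Here \<open>W / pop\<close> is the share of \<open>\<theta>\<close> in the population. Its value on the empty population is
  \<open>0 / 0 = 0\<close>, so the expectation is automatically restricted to a nonempty population.\<close>

lemma expectation_share:
  assumes \<theta>: "\<theta> \<in> Theta n"
  shows "\<bar>real n * expectation (\<lambda>\<omega>. W \<theta> \<omega> / pop \<omega>) - \<kappa> * m \<theta> / mean_pop\<bar> \<le>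
    real n0 * ratio_bound n0 \<kappa>"
proof -
  let ?\<mu> = mean_pop
  have \<mu>: "0 < \<kappa>" "\<kappa> \<le> ?\<mu>" using mean_pop_bounds kappa_range by auto
  have pointwise: "AE \<omega> in PO. \<bar>W \<theta> \<omega> / pop \<omega> - W \<theta> \<omega> / ?\<mu>\<bar> \<le> real n0 / ?\<mu> * (act \<theta> \<omega> * ratio \<theta> \<omega>)"
    using AE_Y_pos[OF \<theta>] AE_space
  proof eventually_elim
    case (elim \<omega>)
    show ?case
    proof (cases "U \<theta> \<omega> = 1")
      case True
      let ?w = "W \<theta> \<omega>" and ?R = "rest \<theta> \<omega>"
      have R: "0 \<le> ?R" by (rule rest_nonneg) (rule elim)
      have w: "1 \<le> ?w" "?w \<le> real n0"
        using True elim(1) W_bounds[OF \<theta> elim(2)] by (auto simp: W_def act_def)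
      have N: "pop \<omega> = ?w + ?R" by (rule pop_eq[OF \<theta>])
      have "\<bar>?w / pop \<omega> - ?w / ?\<mu>\<bar> = ?w * \<bar>?\<mu> - pop \<omega>\<bar> / (pop \<omega> * ?\<mu>)"
      proof -
        have "?w / pop \<omega> - ?w / ?\<mu> = ?w * (?\<mu> - pop \<omega>) / (pop \<omega> * ?\<mu>)"
          using N w R \<mu> by (simp add: field_simps)
        then show ?thesis using N w R \<mu> by (simp add: abs_mult)
      qed
      also have "\<dots> \<le> real n0 * (\<bar>?\<mu> - ?R\<bar> + real n0) / ((1 + ?R) * ?\<mu>)"
        using N w R \<mu> by (intro frac_le mult_mono) auto
      also have "\<dots> = real n0 / ?\<mu> * (act \<theta> \<omega> * ratio \<theta> \<omega>)"
        using True by (simp add: act_def ratio_def)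
      finally show ?thesis .
    qed (simp add: W_def act_def)
  qed
  have int_diff: "integrable PO (\<lambda>\<omega>. W \<theta> \<omega> / pop \<omega> - W \<theta> \<omega> / ?\<mu>)"
    using integrable_share[OF \<theta>] integrable_W[OF \<theta>] by auto
  have "\<bar>expectation (\<lambda>\<omega>. W \<theta> \<omega> / pop \<omega>) - p * m \<theta> / ?\<mu>\<bar> =
      \<bar>expectation (\<lambda>\<omega>. W \<theta> \<omega> / pop \<omega> - W \<theta> \<omega> / ?\<mu>)\<bar>"
    using integrable_share[OF \<theta>] integrable_W[OF \<theta>] by (simp add: expectation_W[OF \<theta>])
  also have "\<dots> \<le> expectation (\<lambda>\<omega>. \<bar>W \<theta> \<omega> / pop \<omega> - W \<theta> \<omega> / ?\<mu>\<bar>)"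
    by (rule integral_abs_bound)
  also have "\<dots> \<le> expectation (\<lambda>\<omega>. real n0 / ?\<mu> * (act \<theta> \<omega> * ratio \<theta> \<omega>))"
    using pointwise int_diff integrable_act_ratio[OF \<theta>] by (intro integral_mono_AE) auto
  also have "\<dots> = real n0 / ?\<mu> * (p * expectation (ratio \<theta>))"
    by (simp add: expectation_act_ratio[OF \<theta>])
  finally have bound: "\<bar>expectation (\<lambda>\<omega>. W \<theta> \<omega> / pop \<omega>) - p * m \<theta> / ?\<mu>\<bar> \<le>
      real n0 / ?\<mu> * (p * expectation (ratio \<theta>))" .
  have n: "0 < real n" using n_ge_2 by simp
  have "real n * expectation (\<lambda>\<omega>. W \<theta> \<omega> / pop \<omega>) - \<kappa> * m \<theta> / ?\<mu> =
      real n * (expectation (\<lambda>\<omega>. W \<theta> \<omega> / pop \<omega>) - p * m \<theta> / ?\<mu>)"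
    using n by (simp add: algebra_simps)
  then have "\<bar>real n * expectation (\<lambda>\<omega>. W \<theta> \<omega> / pop \<omega>) - \<kappa> * m \<theta> / ?\<mu>\<bar> =
      real n * \<bar>expectation (\<lambda>\<omega>. W \<theta> \<omega> / pop \<omega>) - p * m \<theta> / ?\<mu>\<bar>"
    using n by (simp add: abs_mult)
  also have "\<dots> \<le> real n * (real n0 / ?\<mu> * (p * expectation (ratio \<theta>)))"
    using bound n by (intro mult_left_mono) auto
  also have "\<dots> = real n0 * (\<kappa> / ?\<mu>) * expectation (ratio \<theta>)"
    using n by simp
  also have "\<dots> \<le> real n0 * 1 * expectation (ratio \<theta>)"
  proof (intro mult_right_mono mult_left_mono)
    show "0 \<le> expectation (ratio \<theta>)"
      using rest_nonneg by (intro Bochner_Integration.integral_nonneg) (auto simp: ratio_def)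
  qed (use \<mu> in auto)
  also have "\<dots> \<le> real n0 * ratio_bound n0 \<kappa>"
    using expectation_ratio_le[OF \<theta>] by (simp add: mult_left_mono)
  finally show ?thesis .
qed

section \<open>The law of the sampled site\<close>

lemma prob_ZS_eq_sum:
  assumes \<theta>: "\<theta> \<in> Theta n" and Q: "prob_space Q" "space Q = Omega PO n n0" "sets Q = FF PO n n0"
  shows "prob_ZS n n0 Q \<theta> = (\<Sum>k\<in>{0..n0}. measure Q {w \<in> Omega PO n n0. S w = Some (\<theta>, k)})"
proof -
  interpret Q: prob_space Q by (rule Q)
  have "{w \<in> space Q. \<exists>x\<in>K n n0. S w = Some x \<and> Z x = \<theta>} =
      (\<Union>k\<in>{0..n0}. {w \<in> Omega PO n n0. S w = Some (\<theta>, k)})"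
    using \<theta> by (auto simp: Q K_def Z_def)
  moreover have "{w \<in> Omega PO n n0. S w = Some (\<theta>, k)} \<in> sets Q" if "k \<le> n0" for k
  proof -
    have "S -` {Some (\<theta>, k)} \<inter> Omega PO n n0 \<in> FF PO n n0"
      unfolding FF_def using that \<theta> by (intro sigma_sets.Basic) (auto simp: OmegaA_def K_def)
    then show ?thesis by (simp add: Q vimage_def Int_def conj_commute)
  qed
  ultimately show ?thesis
    unfolding prob_ZS_def
    by (simp only:) (rule Q.finite_measure_finite_Union, auto simp: disjoint_family_on_def)
qed

lemma Omega_in_FW: "Omega PO n n0 \<in> FW PO n n0"
  unfolding FW_def Omega_def by blast

lemma mem_K:
  "\<theta> \<in> Theta n \<Longrightarrow> k \<in> {0..n0} \<Longrightarrow> (\<theta>, k) \<in> K n n0"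
  by (simp add: K_def)

lemma prob_ZS_PE:
  assumes PE: "is_PE PO n n0 U Y Q" and \<theta>: "\<theta> \<in> Theta n"
  shows "real n * prob_ZS n n0 Q \<theta> = \<kappa> * m \<theta> / mean_pop"
proof -
  have "expectation (\<lambda>\<omega>. real (card (XX \<omega>))) = expectation pop"
    by (intro Bochner_Integration.integral_cong) (auto simp: card_XX_eq_pop)
  also have "\<dots> = mean_pop"
    unfolding pop_def[abs_def] mean_pop_def
    by (subst Bochner_Integration.integral_sum) (auto simp: integrable_W expectation_W)
  finally have card: "expectation (\<lambda>\<omega>. real (card (XX \<omega>))) = mean_pop" .
  have x: "measure Q {w \<in> Omega PO n n0. S w = Some x} = expectation (\<lambda>\<omega>. indicator (XX \<omega>) x) / mean_pop"
    if "x \<in> K n n0" for x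
  proof -
    have "measure Q (Omega PO n n0 \<inter> {w \<in> Omega PO n n0. S w = Some x}) =
        measure (PW PO n n0) (Omega PO n n0 \<inter> {w \<in> Omega PO n n0. x \<in> X n n0 U Y w}) /
        (\<integral>w. real (card (X n n0 U Y w)) \<partial>PW PO n n0)"
      using PE Omega_in_FW that unfolding is_PE_def by blast
    moreover have "(\<integral>w. real (card (X n n0 U Y w)) \<partial>PW PO n n0) = mean_pop"
      unfolding X_def card[symmetric]
      by (rule integral_PW) (rule measurable_compose[OF measurable_XX], simp)
    moreover have "Omega PO n n0 \<inter> {w \<in> Omega PO n n0. x \<in> X n n0 U Y w} =
        {\<omega> \<in> space PO. x \<in> XX \<omega>} \<times> OmegaA n n0"
      by (auto simp: Omega_def X_def)
    moreover have "prob {\<omega> \<in> space PO. x \<in> XX \<omega>} = expectation (\<lambda>\<omega>. indicator (XX \<omega>) x)"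
    proof -
      have "prob {\<omega> \<in> space PO. x \<in> XX \<omega>} = expectation (indicator {\<omega> \<in> space PO. x \<in> XX \<omega>})"
        by simp
      also have "\<dots> = expectation (\<lambda>\<omega>. indicator (XX \<omega>) x)"
        by (intro Bochner_Integration.integral_cong) (auto simp: indicator_def)
      finally show ?thesis .
    qed
    ultimately show ?thesis by (simp add: measure_PW[OF measurable_mem_XX] Int_absorb1)
  qed
  have "prob_ZS n n0 Q \<theta> = (\<Sum>k\<in>{0..n0}. expectation (\<lambda>\<omega>. indicator (XX \<omega>) (\<theta>, k)) / mean_pop)"
    using PE \<theta> unfolding is_PE_def
    by (subst prob_ZS_eq_sum) (auto simp: x mem_K)
  also have "\<dots> = expectation (\<lambda>\<omega>. \<Sum>k\<in>{0..n0}. indicator (XX \<omega>) (\<theta>, k)) / mean_pop"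
    by (subst Bochner_Integration.integral_sum)
      (auto simp: sum_divide_distrib intro: integrable_of_XX[of "\<lambda>B. indicator B _"])
  also have "expectation (\<lambda>\<omega>. \<Sum>k\<in>{0..n0}. indicator (XX \<omega>) (\<theta>, k)) = expectation (W \<theta>)"
    using sum_fibre_XX[OF \<theta>] by (intro Bochner_Integration.integral_cong) auto
  finally show ?thesis using n_ge_2 by (simp add: expectation_W[OF \<theta>])
qed

lemma expectation_of_XX:
  fixes h :: "(real \<times> nat) set \<Rightarrow> real"
  shows "expectation (\<lambda>\<omega>. h (XX \<omega>)) = (\<Sum>B\<in>Pow (K n n0). h B * prob {\<omega> \<in> space PO. XX \<omega> = B})"
proof -
  have "expectation (\<lambda>\<omega>. h (XX \<omega>)) =
      expectation (\<lambda>\<omega>. \<Sum>B\<in>Pow (K n n0). h B * indicator {\<omega> \<in> space PO. XX \<omega> = B} \<omega>)"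
  proof (intro Bochner_Integration.integral_cong refl)
    fix \<omega> assume "\<omega> \<in> space PO"
    then have "(\<Sum>B\<in>Pow (K n n0). h B * indicator {\<omega> \<in> space PO. XX \<omega> = B} \<omega>) =
        (\<Sum>B\<in>Pow (K n n0). if B = XX \<omega> then h B else 0)"
      by (intro sum.cong) (auto simp: indicator_def)
    then show "h (XX \<omega>) = (\<Sum>B\<in>Pow (K n n0). h B * indicator {\<omega> \<in> space PO. XX \<omega> = B} \<omega>)"
      using XX_subset[of \<omega>] finite_K[of n n0] by simp
  qed
  also have "\<dots> = (\<Sum>B\<in>Pow (K n n0). h B * prob {\<omega> \<in> space PO. XX \<omega> = B})"
    using sets_XX_eq by (subst Bochner_Integration.integral_sum) (auto simp: emeasure_eq_measure)
  finally show ?thesis .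
qed

text \<open>Uniform sampling from a population \<open>B\<close> hits the fibre of \<open>\<theta>\<close> with the share of \<open>\<theta>\<close> in
  \<open>B\<close>; summing over \<open>B\<close> gives the mean share.\<close>

lemma prob_ZS_PL:
  assumes PL: "is_PL PO n n0 U Y Q" and \<theta>: "\<theta> \<in> Theta n"
  shows "prob_ZS n n0 Q \<theta> =
    expectation (\<lambda>\<omega>. W \<theta> \<omega> / pop \<omega>) / prob {\<omega> \<in> space PO. XX \<omega> \<noteq> {}}"
proof -
  let ?q = "prob {\<omega> \<in> space PO. XX \<omega> \<noteq> {}}"
  let ?h = "\<lambda>x B. indicator B x / real (card B) :: real"
  interpret Q: prob_space Q using PL by (simp add: is_PL_def)
  have sets_Q: "sets Q = FF PO n n0" using PL by (simp add: is_PL_def)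
  have x: "measure Q {w \<in> Omega PO n n0. S w = Some x} = expectation (\<lambda>\<omega>. ?h x (XX \<omega>)) / ?q"
    if x: "x \<in> K n n0" for x
  proof -
    let ?E = "\<lambda>B. {w \<in> Omega PO n n0. X n n0 U Y w = B} \<inter> {w \<in> Omega PO n n0. S w = Some x}"
    have part: "measure Q (?E B) = ?h x B * prob {\<omega> \<in> space PO. XX \<omega> = B} / ?q" if B: "B \<subseteq> K n n0" for B
    proof -
      have "measure Q (Omega PO n n0 \<inter> {w \<in> Omega PO n n0. X n n0 U Y w = B} \<inter>
            {w \<in> Omega PO n n0. S w = Some x}) =
          (if x \<in> B then 1 / real (card B) *
            \<P>(w in PW PO n n0. w \<in> Omega PO n n0 \<and> X n n0 U Y w = B \<bar> X n n0 U Y w \<noteq> {}) else 0)"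
        using PL Omega_in_FW x B unfolding is_PL_def by blast
      moreover have "Omega PO n n0 \<inter> {w \<in> Omega PO n n0. X n n0 U Y w = B} =
          {w \<in> Omega PO n n0. X n n0 U Y w = B}" by auto
      moreover have "{w \<in> space (PW PO n n0). (w \<in> Omega PO n n0 \<and> X n n0 U Y w = B) \<and> X n n0 U Y w \<noteq> {}} =
          {\<omega> \<in> space PO. XX \<omega> = B} \<times> OmegaA n n0" if "x \<in> B"
        using that by (auto simp: Omega_def X_def space_PW)
      moreover have "{w \<in> space (PW PO n n0). X n n0 U Y w \<noteq> {}} =
          {\<omega> \<in> space PO. XX \<omega> \<noteq> {}} \<times> OmegaA n n0"
        by (auto simp: Omega_def X_def space_PW)
      moreover have "{\<omega> \<in> space PO. XX \<omega> \<noteq> {}} \<in> events" by measurable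
      ultimately show ?thesis
        by (cases "x \<in> B") (simp_all add: cond_prob_def measure_PW sets_XX_eq)
    qed
    have union: "{w \<in> Omega PO n n0. S w = Some x} = (\<Union>B\<in>Pow (K n n0). ?E B)"
      using XX_subset by (auto simp: X_def)
    have E_sets: "?E B \<in> sets Q" for B
    proof -
      have eq: "{w \<in> Omega PO n n0. X n n0 U Y w = B} = {\<omega> \<in> space PO. XX \<omega> = B} \<times> OmegaA n n0"
        by (auto simp: Omega_def X_def)
      have "{w \<in> Omega PO n n0. X n n0 U Y w = B} \<in> FW PO n n0"
        unfolding eq FW_def using sets_XX_eq[of B] by blast
      then have "{w \<in> Omega PO n n0. X n n0 U Y w = B} \<in> sets Q"
        unfolding sets_Q FF_def by (intro sigma_sets.Basic UnI1)
      moreover have "S -` {Some x} \<inter> Omega PO n n0 \<in> sets Q"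
        unfolding sets_Q FF_def using x by (intro sigma_sets.Basic) (auto simp: OmegaA_def)
      moreover have "S -` {Some x} \<inter> Omega PO n n0 = {w \<in> Omega PO n n0. S w = Some x}" by auto
      ultimately show ?thesis by auto
    qed
    have "measure Q {w \<in> Omega PO n n0. S w = Some x} = measure Q (\<Union>B\<in>Pow (K n n0). ?E B)"
      by (rule arg_cong[OF union])
    also have "\<dots> = (\<Sum>B\<in>Pow (K n n0). measure Q (?E B))"
      using E_sets finite_K
      by (intro Q.finite_measure_finite_Union) (auto simp: disjoint_family_on_def)
    finally have "measure Q {w \<in> Omega PO n n0. S w = Some x} =
        (\<Sum>B\<in>Pow (K n n0). measure Q (?E B))" .
    then show ?thesis
      by (simp add: part expectation_of_XX[of "?h x"] sum_divide_distrib)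
  qed
  have "prob_ZS n n0 Q \<theta> = (\<Sum>k\<in>{0..n0}. expectation (\<lambda>\<omega>. ?h (\<theta>, k) (XX \<omega>)) / ?q)"
    using PL \<theta> unfolding is_PL_def
    by (subst prob_ZS_eq_sum) (auto simp: x mem_K)
  also have "\<dots> = expectation (\<lambda>\<omega>. \<Sum>k\<in>{0..n0}. ?h (\<theta>, k) (XX \<omega>)) / ?q"
    by (subst Bochner_Integration.integral_sum)
      (auto simp: sum_divide_distrib intro: integrable_of_XX[of "?h _"])
  also have "expectation (\<lambda>\<omega>. \<Sum>k\<in>{0..n0}. ?h (\<theta>, k) (XX \<omega>)) = expectation (\<lambda>\<omega>. W \<theta> \<omega> / pop \<omega>)"
    using sum_fibre_XX[OF \<theta>] card_XX_eq_pop
    by (intro Bochner_Integration.integral_cong) (auto simp flip: sum_divide_distrib)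
  finally show ?thesis .
qed

lemma mean_pop_eq_Riemann_sum: "mean_pop = \<kappa> * ((\<Sum>i<n. m (real i / real n)) / real n)"
  by (simp add: mean_pop_def sum_Theta sum_distrib_left sum_divide_distrib)

lemma Riemann_sum_ge_1: "1 \<le> (\<Sum>i<n. m (real i / real n)) / real n"
proof -
  have "\<kappa> * 1 \<le> \<kappa> * ((\<Sum>i<n. m (real i / real n)) / real n)"
    using mean_pop_bounds(1) by (simp only: mean_pop_eq_Riemann_sum mult_1_right)
  then show ?thesis using kappa_range(1) by (simp only: mult_le_cancel_left_pos)
qed

end

section \<open>The limits\<close>

theorem lemma4p2:
  fixes n0 :: nat and m :: "real \<Rightarrow> real" and \<alpha> \<theta> :: real and \<kappa> :: "nat \<Rightarrow> real"
    and PO :: "nat \<Rightarrow> 'w measure"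
    and U Y :: "nat \<Rightarrow> real \<Rightarrow> 'w \<Rightarrow> nat"
    and PE PL :: "nat \<Rightarrow> ('w \<times> (real \<times> nat) option) measure"
  assumes "continuous_on {0..1} m"
    and "0 < \<alpha>" and "\<alpha> < 1"
    and "\<And>n. n \<ge> 2 \<Longrightarrow> \<kappa> n = real n powr (1 - \<alpha>)"
    and "\<And>n. n \<ge> 2 \<Longrightarrow> original_space (PO n) n n0 m (\<kappa> n) (U n) (Y n)"
    and "\<And>n. n \<ge> 2 \<Longrightarrow> is_PE (PO n) n n0 (U n) (Y n) (PE n)"
    and "\<And>n. n \<ge> 2 \<Longrightarrow> is_PL (PO n) n n0 (U n) (Y n) (PL n)"
    and "\<theta> \<in> \<rat>" and "0 \<le> \<theta>" and "\<theta> < 1"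
  shows "((\<lambda>n. real n * prob_ZS n n0 (PL n) \<theta>) \<longlongrightarrow> m \<theta> / integral {0..1} m)
           (inf sequentially (principal {n. \<theta> \<in> Theta n})) \<and>
         ((\<lambda>n. real n * prob_ZS n n0 (PE n) \<theta>) \<longlongrightarrow> m \<theta> / integral {0..1} m)
           (inf sequentially (principal {n. \<theta> \<in> Theta n}))"
proof -
  let ?F = "inf sequentially (principal {n. \<theta> \<in> Theta n})"
  define M where "M n = (\<Sum>i<n. m (real i / real n)) / real n" for n
  have site: "eventually (\<lambda>n. 2 \<le> n \<and> \<theta> \<in> Theta n) ?F"
    unfolding eventually_inf_principal
    using eventually_ge_at_top[of 2] by eventually_elim simp
  have down: "(f \<longlongrightarrow> c) ?F" if "f \<longlonglongrightarrow> c" for f :: "nat \<Rightarrow> real" and c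
    using tendsto_mono[OF inf_le1 that] .
  have M: "M \<longlonglongrightarrow> integral {0..1} m"
    unfolding M_def by (rule left_Riemann_sum_tendsto_integral[OF assms(1)])
  have "1 \<le> integral {0..1} m"
  proof (rule tendsto_lowerbound[OF M])
    show "eventually (\<lambda>n. 1 \<le> M n) sequentially"
      using eventually_ge_at_top[of 2]
      unfolding M_def by eventually_elim (rule original_space.Riemann_sum_ge_1[OF assms(5)])
  qed simp
  then have target: "((\<lambda>n. m \<theta> / M n) \<longlongrightarrow> m \<theta> / integral {0..1} m) ?F"
    by (intro down tendsto_divide tendsto_const M) auto
  have "filterlim (\<lambda>n. real n powr (1 - \<alpha>)) at_top sequentially"
    using assms(3) by real_asymp
  then have \<kappa>: "filterlim \<kappa> at_top sequentially"
    by (rule filterlim_mono_eventually[OF _ order_refl order_refl])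
      (use eventually_ge_at_top[of 2] in eventually_elim, simp add: assms(4))
  have E: "((\<lambda>n. real n * prob_ZS n n0 (PE n) \<theta>) \<longlongrightarrow> m \<theta> / integral {0..1} m) ?F"
    using target
  proof (rule Lim_transform_eventually)
    show "eventually (\<lambda>n. m \<theta> / M n = real n * prob_ZS n n0 (PE n) \<theta>) ?F"
      using site
    proof eventually_elim
      case (elim n)
      interpret original_space "PO n" n n0 m "\<kappa> n" "U n" "Y n" using elim assms(5) by simp
      show ?case
        using prob_ZS_PE[OF assms(6)] kappa_range elim by (simp add: M_def mean_pop_eq_Riemann_sum)
    qed
  qed
  define q where "q n = measure (PO n) {\<omega> \<in> space (PO n). XO n n0 (U n) (Y n) \<omega> \<noteq> {}}" for n
  have q: "q \<longlonglongrightarrow> 1"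
  proof (rule tendsto_sandwich)
    have "((\<lambda>x::real. 1 - exp (- x / 4)) \<longlongrightarrow> 1) at_top" by real_asymp
    then show "(\<lambda>n. 1 - exp (- \<kappa> n / 4)) \<longlonglongrightarrow> 1" by (rule filterlim_compose[OF _ \<kappa>])
    show "(\<lambda>n. 1) \<longlonglongrightarrow> (1::real)" by simp
    show "eventually (\<lambda>n. 1 - exp (- \<kappa> n / 4) \<le> q n) sequentially"
      using eventually_ge_at_top[of 2]
      unfolding q_def by eventually_elim (rule original_space.prob_XX_nonempty_ge[OF assms(5)])
    show "eventually (\<lambda>n. q n \<le> 1) sequentially"
      using eventually_ge_at_top[of 2]
    proof eventually_elim
      case (elim n)
      interpret original_space "PO n" n n0 m "\<kappa> n" "U n" "Y n" using elim assms(5) by simp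
      show ?case by (simp add: q_def)
    qed
  qed
  have err: "(\<lambda>n. real n0 * ratio_bound n0 (\<kappa> n)) \<longlonglongrightarrow> 0"
    using tendsto_mult[OF tendsto_const filterlim_compose[OF ratio_bound_tendsto_0 \<kappa>]] by simp
  have "((\<lambda>n. real n * prob_ZS n n0 (PL n) \<theta> * q n - m \<theta> / M n) \<longlongrightarrow> 0) ?F"
  proof (rule tendsto_0_le[OF down[OF err], where K = 1])
    show "eventually (\<lambda>n. norm (real n * prob_ZS n n0 (PL n) \<theta> * q n - m \<theta> / M n) \<le>
        norm (real n0 * ratio_bound n0 (\<kappa> n)) * 1) ?F"
      using site
    proof eventually_elim
      case (elim n)
      interpret original_space "PO n" n n0 m "\<kappa> n" "U n" "Y n" using elim assms(5) by simp
      have "q n \<noteq> 0" using prob_XX_nonempty by (simp add: q_def)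
      then have "real n * prob_ZS n n0 (PL n) \<theta> * q n = real n * expectation (\<lambda>\<omega>. W \<theta> \<omega> / pop \<omega>)"
        using prob_ZS_PL[OF assms(7)] elim by (simp add: q_def)
      moreover have "m \<theta> / M n = \<kappa> n * m \<theta> / mean_pop"
        using kappa_range by (simp add: M_def mean_pop_eq_Riemann_sum)
      ultimately show ?case
        using expectation_share[OF conjunct2[OF elim]] by (simp only: real_norm_def)
    qed
  qed
  from tendsto_add[OF this target]
  have "((\<lambda>n. real n * prob_ZS n n0 (PL n) \<theta> * q n) \<longlongrightarrow> m \<theta> / integral {0..1} m) ?F" by simp
  from tendsto_divide[OF this down[OF q]]
  have "((\<lambda>n. real n * prob_ZS n n0 (PL n) \<theta> * q n / q n) \<longlongrightarrow> m \<theta> / integral {0..1} m) ?F" by simp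
  then have "((\<lambda>n. real n * prob_ZS n n0 (PL n) \<theta>) \<longlongrightarrow> m \<theta> / integral {0..1} m) ?F"
  proof (rule Lim_transform_eventually)
    show "eventually (\<lambda>n. real n * prob_ZS n n0 (PL n) \<theta> * q n / q n = real n * prob_ZS n n0 (PL n) \<theta>) ?F"
      using site
    proof eventually_elim
      case (elim n)
      interpret original_space "PO n" n n0 m "\<kappa> n" "U n" "Y n" using elim assms(5) by simp
      show ?case using prob_XX_nonempty by (simp add: q_def)
    qed
  qed
  with E show ?thesis by blast
qed

end
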